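(* Let $\mathrm{g}\colon\mathbb{C}\to\mathbb{R}$ be a continuous function with $\mathrm{g}(z)=\log|z|+o(\log|z|)$ as $|z|\to\infty$. Then $\mathcal{D}(\mathrm{g})=\mathcal{P}(\mathrm{g})\in\mathbb{R}$.
   Context: $\mathscr{P}_{\log}(\mathbb{C})$ is the set of Borel probability measures $\mu$ on $\mathbb{C}$ with $\int\log^+|z|\,d\mu<\infty$. Fix an enumeration $Q_1,Q_2,\dots$ of all nonconstant primitive irreducible polynomials in $\mathbb{Z}[x]$. Define $$\mathcal{P}(\mathrm{g})=\inf\Big\{\int\mathrm{g}\,d\mu\;\Big|\;\mu\in\mathscr{P}_{\log}(\mathbb{C}),\ \int\log|Q_n|\,d\mu\ge0\text{ for all }n\Big\},$$ $$\mathcal{D}(\mathrm{g})=\sup_a\ \inf_{z\in\mathbb{C}}\Big(\mathrm{g}(z)-\sum_n a_n\log|Q_n(z)|\Big),$$ the supremum over sequences $a=(a_n)_{n\ge1}$ of nonnegative reals with only finitely many nonzero terms. *)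

theory Defs
  imports
    "HOL-Probability.Probability"
    "HOL-Computational_Algebra.Computational_Algebra"
begin

text \<open>
  The library's \<^term>\<open>ln :: real \<Rightarrow> real\<close> returns the junk value 0 at 0.  For
  \<open>log |Q(z)|\<close> the value at a zero of \<open>Q\<close> has to be \<open>-\<infinity>\<close>: a measure with an atom at a
  zero of \<open>Q\<close> violates \<open>\<integral> log |Q| d\<mu> \<ge> 0\<close>.
\<close>

definition elog :: "real \<Rightarrow> ereal" where
  "elog x = (if x = 0 then -\<infinity> else ereal (ln x))"

definition log_abs_poly :: "int poly \<Rightarrow> complex \<Rightarrow> ereal" where
  "log_abs_poly p z = elog (cmod (poly (map_poly of_int p) z))"

text \<open>
  The value is meaningful if at least one of the two parts is finite.  For
  \<open>f = log |Q|\<close> and \<open>\<mu>\<close> with finite logarithmic moment the positive part is always finite,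
  and the integral may be \<open>-\<infinity>\<close>.
\<close>

definition ext_integral :: "'a measure \<Rightarrow> ('a \<Rightarrow> ereal) \<Rightarrow> ereal" where
  "ext_integral M f =
     enn2ereal (\<integral>\<^sup>+ x. e2ennreal (f x) \<partial>M) - enn2ereal (\<integral>\<^sup>+ x. e2ennreal (- f x) \<partial>M)"

definition P_log :: "complex measure set" where
  "P_log = {\<mu>. prob_space \<mu> \<and> sets \<mu> = sets borel \<and>
               (\<integral>\<^sup>+ z. ennreal (max 0 (ln (cmod z))) \<partial>\<mu>) < \<infinity>}"

definition primitive_irreducible_polys :: "int poly set" where
  "primitive_irreducible_polys = {p. degree p > 0 \<and> content p = 1 \<and> irreducible p}"

definition primal_feasible :: "(nat \<Rightarrow> int poly) \<Rightarrow> complex measure set" where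
  "primal_feasible Q = {\<mu> \<in> P_log. \<forall>n. ext_integral \<mu> (log_abs_poly (Q n)) \<ge> 0}"

definition primal_value :: "(nat \<Rightarrow> int poly) \<Rightarrow> (complex \<Rightarrow> real) \<Rightarrow> ereal" where
  "primal_value Q g = (INF \<mu> \<in> primal_feasible Q. ext_integral \<mu> (\<lambda>z. ereal (g z)))"

definition dual_feasible :: "(nat \<Rightarrow> real) set" where
  "dual_feasible = {a. (\<forall>n. a n \<ge> 0) \<and> finite {n. a n \<noteq> 0}}"

definition dual_value :: "(nat \<Rightarrow> int poly) \<Rightarrow> (complex \<Rightarrow> real) \<Rightarrow> ereal" where
  "dual_value Q g =
     (SUP a \<in> dual_feasible. INF z.
        ereal (g z) - (\<Sum>n | a n \<noteq> 0. ereal (a n) * log_abs_poly (Q n) z))"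

end

theory Submission
  imports Defs
begin

text \<open>
  The constraints are dualised one at a time over finitely supported measures; a point mass far
  out is a Slater point for finitely many of them.  So for every real \<open>v\<close> above the dual value
  and every \<open>N\<close> there is a finitely supported probability measure satisfying the first \<open>N\<close>
  constraints with \<open>\<integral> g < v\<close>.  As \<open>g\<close> controls \<open>log\<^sup>+ |z|\<close>, a subsequence converges
  weakly, say to \<open>\<mu>\<close>, while an amount \<open>c \<ge> 0\<close> of the integral of \<open>log\<^sup>+ |z|\<close> escapes to infinity:
  in the limit \<open>\<integral> g d\<mu> + c \<le> v\<close> and \<open>\<integral> log |Q\<^sub>n| d\<mu> + c deg Q\<^sub>n \<ge> 0\<close> for all \<open>n\<close>.  The
  defect is repaired by giving mass about \<open>c / log R\<close> to the uniform measure on \<open>[0, R]\<close>, whose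
  integral of \<open>log |Q\<^sub>n|\<close> is at least \<open>deg Q\<^sub>n (log R - 4)\<close>; letting \<open>R\<close> tend to infinity shows
  that the primal value is at most \<open>v\<close>.
\<close>

subsection \<open>A space-filling curve\<close>

text \<open>The obstacle is that infinitely many constraints involve functions
  \<open>log |Q|\<close> unbounded both near the zeros of Q and at infinity. In a weak limit the two
  defects differ. Near a zero the logarithm is upper semicontinuous, which is exactly the direction
  that the constraints need. At infinity the loss is real but has a single parameter: g and log |Q|
  grow like 1 and deg Q times log |z|, so one number c describes the defect of every constraint, and
  mass far out returns deg Q in a constraint for each unit that it costs in g. That one measure
  repairs all constraints at once rests on integrality: leading coefficients have modulus at least
  1, and the lower bound on the segment does not depend on where the roots lie. Finite supports turn
  expectations into finite sums, and supports avoiding the zeros keep the logarithms real.\<close>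

definition bump :: "real \<Rightarrow> real" where
  "bump t = max 0 (min 1 (1/2 - cos (pi * t)))"

lemma bump_bounds: "0 \<le> bump t" "bump t \<le> 1"
  by (auto simp: bump_def)

lemma continuous_on_bump: "continuous_on A bump"
  unfolding bump_def by (intro continuous_intros)

lemma cos_add_even: "cos (pi * (2 * real N + x)) = cos (pi * x)"
proof -
  have "cos (pi * (2 * real N + x)) = cos (2 * pi * real N + pi * x)"
    by (simp add: algebra_simps)
  also have "\<dots> = cos (pi * x)"
    using cos_integer_2pi[of "real N"] sin_integer_2pi[of "real N"] by (simp only: cos_add) simp
  finally show ?thesis .
qed

lemma bump_add_even: "bump (2 * real N + x) = bump x"
  by (simp only: bump_def cos_add_even)

text \<open>The cosine is 1/2 at pi/3 and -1/2 at 2 pi/3, so clipping 1/2 - cos to [0, 1] leaves it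
  constant on the outer thirds of [0, 1], where the ternary digits are 0 and 2.\<close>

lemma bump_eq_0:
  assumes "0 \<le> x" "x \<le> 1/3"
  shows "bump x = 0"
proof -
  have "cos (pi * x) \<ge> cos (pi / 3)"
    using assms by (intro cos_monotone_0_pi_le) auto
  then show ?thesis by (simp add: bump_def cos_60)
qed

lemma bump_eq_1:
  assumes "2/3 \<le> x" "x \<le> 1"
  shows "bump x = 1"
proof -
  have "cos (pi * x) \<le> cos (pi * (2 / 3))"
    using assms by (intro cos_monotone_0_pi_le) auto
  also have "cos (pi * (2/3)) = - 1 / 2"
    using cos_120 by (simp add: mult.commute)
  finally show ?thesis by (simp add: bump_def)
qed

text \<open>Multiplication by 3^k turns the digits before k, and the shift 2m, into even integers,
  which the period 2 absorbs. Digit k contributes 0 or 2/3 and the tail at most 1/3, so the argument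
  lands in a third where \<open>bump\<close> is constant.\<close>

lemma bump_ternary:
  fixes a :: "nat \<Rightarrow> nat"
  assumes a: "\<And>i. a i \<le> 1"
  shows "bump (3 ^ k * (2 * real m + (\<Sum>i. 2 * real (a i) / 3 ^ Suc i))) = real (a k)"
proof -
  let ?f = "\<lambda>i. 2 * real (a i) / 3 ^ Suc i"
  have geo: "summable (\<lambda>i. 2 * (1/3::real) ^ Suc i)"
    by (intro summable_mult) (simp add: summable_geometric summable_Suc_iff)
  have le: "?f i \<le> 2 * (1/3) ^ Suc i" for i
    using a[of i] by (simp add: power_one_over divide_simps)
  have sf: "summable ?f"
    by (rule summable_comparison_test'[OF geo, of 0]) (use le in auto)
  define r where "r = (\<Sum>i. ?f (i + Suc k))"
  have sr: "summable (\<lambda>i. ?f (i + Suc k))"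
    using sf by (rule summable_ignore_initial_segment)
  have sg: "summable (\<lambda>i. (2 * (1/3) ^ Suc (Suc k)) * (1/3::real) ^ i)"
    by (intro summable_mult summable_geometric) auto
  have "r \<le> (\<Sum>i. (2 * (1/3) ^ Suc (Suc k)) * (1/3) ^ i)"
    unfolding r_def
    by (rule suminf_le[OF _ sr sg])
       (use le[of "_ + Suc k"] in \<open>simp add: power_add mult_ac power_one_over\<close>)
  also have "\<dots> = 2 * (1/3) ^ Suc (Suc k) * (3/2)"
    by (subst suminf_mult) (simp_all add: suminf_geometric summable_geometric)
  finally have r1: "3 ^ k * r \<le> 1/3"
    by (simp add: power_one_over divide_simps mult_ac)
  have r0: "3 ^ k * r \<ge> 0"
    unfolding r_def by (intro mult_nonneg_nonneg suminf_nonneg sr) auto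
  define N where "N = 3 ^ k * m + (\<Sum>i<k. a i * 3 ^ (k - Suc i))"
  have "(\<Sum>i. ?f i) = r + (\<Sum>i<Suc k. ?f i)"
    unfolding r_def by (rule suminf_split_initial_segment[OF sf])
  then have "3 ^ k * (2 * real m + (\<Sum>i. ?f i))
      = 3 ^ k * 2 * real m + 3 ^ k * r + (\<Sum>i<k. 3 ^ k * ?f i) + 3 ^ k * ?f k"
    by (simp add: algebra_simps sum_distrib_left)
  also have "(\<Sum>i<k. 3 ^ k * ?f i) = (\<Sum>i<k. 2 * (real (a i) * 3 ^ (k - Suc i)))"
  proof (rule sum.cong)
    fix i assume "i \<in> {..<k}"
    then have "(3::real) ^ k = 3 ^ Suc i * 3 ^ (k - Suc i)"
      by (subst power_add[symmetric]) auto
    then show "3 ^ k * ?f i = 2 * (real (a i) * 3 ^ (k - Suc i))" by simp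
  qed simp
  also have "3 ^ k * 2 * real m + 3 ^ k * r + (\<Sum>i<k. 2 * (real (a i) * 3 ^ (k - Suc i))) + 3 ^ k * ?f k
     = 2 * real N + (3 ^ k * r + 2 * real (a k) / 3)"
    by (simp add: N_def sum_distrib_left)
  finally have *: "bump (3 ^ k * (2 * real m + (\<Sum>i. ?f i))) = bump (3 ^ k * r + 2 * real (a k) / 3)"
    by (simp only: bump_add_even)
  have "a k = 0 \<or> a k = 1" using a[of k] by auto
  then show ?thesis
    unfolding * using r0 r1 by (auto intro!: bump_eq_0 bump_eq_1)
qed

text \<open>Schoenberg's curve: \<open>bump\<close> reads off the ternary digits (0 or 2) of a point of the
  Cantor set, and the digits of even and odd index serve as binary digits of two coordinates.\<close>

definition schoenberg :: "nat \<Rightarrow> real \<Rightarrow> real" where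
  "schoenberg e t = (\<Sum>k. bump (3 ^ (2 * k + e) * t) / 2 ^ Suc k)"

lemma continuous_on_schoenberg: "continuous_on UNIV (schoenberg e)"
proof -
  have "uniform_limit UNIV (\<lambda>n t. \<Sum>k<n. bump (3 ^ (2 * k + e) * t) / 2 ^ Suc k)
     (\<lambda>t. \<Sum>k. bump (3 ^ (2 * k + e) * t) / 2 ^ Suc k) sequentially"
  proof (rule Weierstrass_m_test)
    show "summable (\<lambda>n. (1/2::real) ^ Suc n)"
      by (simp only: summable_Suc_iff) (simp add: summable_geometric)
    show "norm (bump (3 ^ (2 * n + e) * x) / 2 ^ Suc n) \<le> (1/2) ^ Suc n" for n x
      using bump_bounds[of "3 ^ (2 * n + e) * x"] by (simp add: power_one_over divide_simps)
  qed
  then show ?thesis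
    unfolding schoenberg_def
    by (rule uniform_limit_theorem[rotated])
       (auto intro!: always_eventually continuous_intros
          continuous_on_compose2[OF continuous_on_bump[of UNIV]])
qed

text \<open>The digits are differences of the floors of 2^n u, so the partial sums telescope to
  those floors divided by 2^n, within 2^-n of u.\<close>

lemma binary_expansion:
  fixes u :: real
  assumes "0 \<le> u" "u < 1"
  obtains a :: "nat \<Rightarrow> nat" where "\<And>i. a i \<le> 1" "(\<lambda>i. real (a i) / 2 ^ Suc i) sums u"
proof
  define b where "b n = nat \<lfloor>2 ^ n * u\<rfloor>" for n
  have b: "real (b n) \<le> 2 ^ n * u" "2 ^ n * u < real (b n) + 1" for n
    using assms by (auto simp: b_def of_nat_floor)
  have b2: "2 * b n \<le> b (Suc n)" "b (Suc n) \<le> 2 * b n + 1" for n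
    using b[of n] b[of "Suc n"] by auto
  define a where "a i = b (Suc i) - 2 * b i" for i
  show "a i \<le> 1" for i using b2[of i] by (simp add: a_def)
  have ps: "(\<Sum>i<n. real (a i) / 2 ^ Suc i) = real (b n) / 2 ^ n" for n
  proof (induction n)
    case 0
    have "\<lfloor>u\<rfloor> = 0" using assms by linarith
    then show ?case by (simp add: b_def)
  next
    case (Suc n)
    have "real (a n) = real (b (Suc n)) - 2 * real (b n)"
      using b2[of n] by (simp add: a_def of_nat_diff)
    with Suc show ?case by (simp add: field_simps)
  qed
  have "(\<lambda>n. real (b n) / 2 ^ n) \<longlonglongrightarrow> u"
  proof (rule tendsto_sandwich)
    show "(\<lambda>n. u - (1/2) ^ n) \<longlonglongrightarrow> u"
      by (rule tendsto_eq_intros LIMSEQ_power_zero refl | simp)+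
    show "\<forall>\<^sub>F n in sequentially. u - (1/2) ^ n \<le> real (b n) / 2 ^ n"
    proof (intro always_eventually allI)
      show "u - (1/2) ^ n \<le> real (b n) / 2 ^ n" for n
        using b(2)[of n] by (simp add: power_one_over divide_simps) (simp add: algebra_simps)
    qed
    show "\<forall>\<^sub>F n in sequentially. real (b n) / 2 ^ n \<le> u"
      using b(1) by (intro always_eventually allI) (simp add: field_simps)
  qed simp
  then show "(\<lambda>i. real (a i) / 2 ^ Suc i) sums u"
    by (simp only: sums_def ps)
qed

text \<open>One s serves all m by periodicity. Hence every interval [2m, 2m + 1] carries a full copy
  of the curve, and each copy can be given its own scale.\<close>

lemma schoenberg_surj:
  assumes "0 \<le> u" "u < 1" "0 \<le> v" "v < 1"
  shows "\<exists>s\<in>{0..1}. \<forall>m::nat. schoenberg 0 (2 * real m + s) = u \<and> schoenberg 1 (2 * real m + s) = v"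
proof -
  obtain a where a: "\<And>i. a i \<le> 1" "(\<lambda>i. real (a i) / 2 ^ Suc i) sums u"
    using binary_expansion assms(1,2) by blast
  obtain b where b: "\<And>i. b i \<le> 1" "(\<lambda>i. real (b i) / 2 ^ Suc i) sums v"
    using binary_expansion assms(3,4) by blast
  define c where "c i = (if even i then a (i div 2) else b (i div 2))" for i
  have c: "c i \<le> 1" for i using a(1) b(1) by (simp add: c_def)
  define s where "s = (\<Sum>i. 2 * real (c i) / 3 ^ Suc i)"
  have sg: "summable (\<lambda>i. 2 / 3 * (1/3::real) ^ i)"
    by (intro summable_mult summable_geometric) auto
  have le: "2 * real (c i) / 3 ^ Suc i \<le> 2 / 3 * (1/3) ^ i" for i
    using c[of i] by (simp add: power_one_over divide_simps)
  have sc: "summable (\<lambda>i. 2 * real (c i) / 3 ^ Suc i)"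
    by (rule summable_comparison_test'[OF sg, of 0]) (use le in auto)
  have "s \<le> (\<Sum>i. 2 / 3 * (1/3) ^ i)"
    unfolding s_def by (rule suminf_le[OF le sc sg])
  also have "\<dots> = 1"
    by (subst suminf_mult) (simp_all add: suminf_geometric summable_geometric)
  finally have "s \<in> {0..1}"
    unfolding s_def using suminf_nonneg[OF sc] by simp
  moreover have "schoenberg 0 (2 * real m + s) = u \<and> schoenberg 1 (2 * real m + s) = v" for m
    using sums_unique[OF a(2)] sums_unique[OF b(2)]
    by (simp add: schoenberg_def s_def bump_ternary[of c, OF c] del: power_Suc) (simp add: c_def)
  ultimately show ?thesis by blast
qed

text \<open>The term \<open>arccos (cos (pi * t)) / pi\<close> is the distance from t to the nearest
  even integer. The first factor is therefore a continuous staircase that rises only between an odd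
  integer and the next even one; the second factor stays in the square [-1, 1]^2.\<close>

definition plane_curve :: "real \<Rightarrow> complex" where
  "plane_curve t = of_real ((t - arccos (cos (pi * t)) / pi) / 2) *
     Complex (2 * schoenberg 0 t - 1) (2 * schoenberg 1 t - 1)"

lemma continuous_on_plane_curve: "continuous_on UNIV plane_curve"
  unfolding plane_curve_def Complex_eq
  by (intro continuous_intros continuous_on_subset[OF continuous_on_schoenberg]) auto

text \<open>On \<open>[2k, 2k + 1]\<close> the radial factor of the curve is the constant \<open>k\<close>, so that this
  piece of the curve covers the square of half-width \<open>k\<close>.\<close>

lemma plane_curve_section:
  obtains s where "\<And>z. plane_curve (s z) = z" "\<And>z. \<bar>s z\<bar> \<le> 2 * cmod z + 5"
proof -
  have "\<exists>t. plane_curve t = z \<and> \<bar>t\<bar> \<le> 2 * cmod z + 5" for z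
  proof -
    \<comment> \<open>Strictly larger than |z|, so that both rescaled coordinates lie in the
      half-open interval required by \<open>schoenberg_surj\<close>.\<close>
    define k where "k = nat \<lfloor>cmod z\<rfloor> + 1"
    have k: "cmod z < real k" "real k \<le> cmod z + 1" "k > 0"
      unfolding k_def using floor_correct[of "cmod z"] by (simp_all, linarith)
    have re: "\<bar>Re z\<bar> < k" and im: "\<bar>Im z\<bar> < k"
      using k(1) abs_Re_le_cmod[of z] abs_Im_le_cmod[of z] by auto
    have "0 \<le> (Re z / k + 1) / 2" "(Re z / k + 1) / 2 < 1"
      "0 \<le> (Im z / k + 1) / 2" "(Im z / k + 1) / 2 < 1"
      using re im k(3) by (auto simp: field_simps)
    from schoenberg_surj[OF this] obtain s where s: "s \<in> {0..1}"
      and eq: "schoenberg 0 (2 * real k + s) = (Re z / k + 1) / 2"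
        "schoenberg 1 (2 * real k + s) = (Im z / k + 1) / 2" by blast
    have "arccos (cos (pi * (2 * real k + s))) = pi * s"
      using s by (simp only: cos_add_even) (simp add: arccos_cos)
    then have "plane_curve (2 * real k + s) = of_real (real k) * Complex (Re z / k) (Im z / k)"
      unfolding plane_curve_def eq by (simp add: add_divide_distrib)
    also have "\<dots> = z"
      using k(3) by (intro complex_eqI) auto
    finally show ?thesis using s k by (intro exI[of _ "2 * real k + s"]) auto
  qed
  then show ?thesis using that by metis
qed

subsection \<open>Weak limits of finitely supported measures\<close>

definition log_plus :: "complex \<Rightarrow> real" where
  "log_plus z = max 0 (ln (cmod z))"

lemma log_plus_nonneg: "0 \<le> log_plus z"
  by (simp add: log_plus_def)

lemma log_plus_eq: "log_plus z = ln (max 1 (cmod z))"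
  by (cases "z = 0") (auto simp: log_plus_def max_def)

lemma continuous_on_log_plus: "continuous_on A log_plus"
  unfolding log_plus_eq[abs_def] by (intro continuous_intros) (auto simp: max_def)

lemma borel_measurable_log_plus [measurable]: "log_plus \<in> borel_measurable borel"
  by (intro borel_measurable_continuous_onI continuous_on_log_plus)

text \<open>Markov's inequality for \<open>log_plus\<close> bounds the mass outside a disc, and the
  linear bound on s carries discs into intervals. The section s is an arbitrary choice function; it
  is measurable because every set is measurable for a pmf.\<close>

lemma tight_pmf_section:
  fixes p :: "nat \<Rightarrow> complex pmf"
  assumes fin: "\<And>n. finite (set_pmf (p n))"
    and C: "\<And>n. measure_pmf.expectation (p n) log_plus \<le> C"
    and s: "\<And>z. \<bar>s z\<bar> \<le> 2 * cmod z + 5"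
  shows "tight (\<lambda>n. distr (measure_pmf (p n)) borel s)"
  unfolding tight_def
proof (intro conjI allI impI)
  fix n show "real_distribution (distr (measure_pmf (p n)) borel s)"
    by (rule prob_space.real_distribution_distr[OF measure_pmf.prob_space_axioms]) auto
next
  fix \<epsilon> :: real assume "\<epsilon> > 0"
  define T where "T = (\<bar>C\<bar> + 1) / \<epsilon>"
  have T: "T > 0" "\<epsilon> * T = \<bar>C\<bar> + 1" using \<open>\<epsilon> > 0\<close> by (auto simp: T_def)
  \<comment> \<open>If \<open>log_plus z < T\<close> then |z| < exp T, so |s z| is below 2 exp T +
    5.\<close>
  define b where "b = 2 * exp T + 6"
  have "1 - \<epsilon> < measure (distr (measure_pmf (p n)) borel s) {- b<..b}" for n
  proof -
    have int: "integrable (measure_pmf (p n)) log_plus"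
      by (rule integrable_measure_pmf_finite[OF fin])
    have "measure (measure_pmf (p n)) {z. log_plus z \<ge> T}
        \<le> measure_pmf.expectation (p n) log_plus / T"
      using integral_Markov_inequality_measure[OF int _ _ T(1), of "{}"] log_plus_nonneg
      by simp
    also have "\<dots> < \<epsilon>" using C[of n] T by (simp add: divide_simps)
    finally have m: "measure (measure_pmf (p n)) {z. log_plus z \<ge> T} < \<epsilon>" .
    have "z \<in> s -` {- b<..b}" if "\<not> log_plus z \<ge> T" for z
    proof -
      have "ln (max 1 (cmod z)) < T" using that by (simp add: log_plus_eq)
      then have "max 1 (cmod z) < exp T"
        by (metis exp_less_cancel_iff exp_ln less_max_iff_disj zero_less_one)
      then show ?thesis using s[of z] by (auto simp: b_def)
    qed
    then have "- {z. log_plus z \<ge> T} \<subseteq> s -` {- b<..b}" by auto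
    then have "measure (measure_pmf (p n)) (- {z. log_plus z \<ge> T})
        \<le> measure (measure_pmf (p n)) (s -` {- b<..b})"
      by (intro measure_pmf.finite_measure_mono) auto
    moreover have "measure (measure_pmf (p n)) (- {z. log_plus z \<ge> T})
        = 1 - measure (measure_pmf (p n)) {z. log_plus z \<ge> T}"
      using measure_pmf.prob_compl[of "{z. log_plus z \<ge> T}" "p n"] by (simp add: Compl_eq_Diff_UNIV)
    ultimately show ?thesis using m by (simp add: measure_distr)
  qed
  moreover have "- b < b" by (simp add: b_def add_pos_pos)
  ultimately show "\<exists>a b. a < b \<and> (\<forall>n. 1 - \<epsilon> < measure (distr (measure_pmf (p n)) borel s) {a<..b})"
    by blast
qed

text \<open>Helly's selection theorem is available on the real line only.  The measures are lifted
  to the line through a section of the plane curve, and the limit is pushed forward.\<close>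

lemma pmf_weak_limit:
  fixes p :: "nat \<Rightarrow> complex pmf"
  assumes fin: "\<And>n. finite (set_pmf (p n))"
    and C: "\<And>n. measure_pmf.expectation (p n) log_plus \<le> C"
  obtains r \<mu> where "strict_mono (r :: nat \<Rightarrow> nat)" "prob_space \<mu>" "sets \<mu> = sets borel"
    "\<And>(h :: complex \<Rightarrow> real) B. continuous_on UNIV h \<Longrightarrow> (\<And>z. \<bar>h z\<bar> \<le> B) \<Longrightarrow>
       (\<lambda>n. measure_pmf.expectation (p (r n)) h) \<longlonglongrightarrow> integral\<^sup>L \<mu> h"
proof -
  obtain s where s: "\<And>z. plane_curve (s z) = z" "\<And>z. \<bar>s z\<bar> \<le> 2 * cmod z + 5"
    using plane_curve_section by blast
  have "tight (\<lambda>n. distr (measure_pmf (p n)) borel s)"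
    by (rule tight_pmf_section[OF fin C s(2)])
  from tight_imp_convergent_subsubsequence[OF this strict_mono_id] obtain r M where
    r: "strict_mono (r :: nat \<Rightarrow> nat)" and M: "real_distribution M"
    and w: "weak_conv_m ((\<lambda>n. distr (measure_pmf (p n)) borel s) \<circ> r) M"
    by auto
  interpret M: real_distribution M by fact
  have pm [measurable]: "plane_curve \<in> borel_measurable borel"
    by (intro borel_measurable_continuous_onI continuous_on_plane_curve)
  show ?thesis
  proof (rule that[of r "distr M borel plane_curve"])
    show "prob_space (distr M borel plane_curve)"
      by (rule M.prob_space_distr) simp
    fix h :: "complex \<Rightarrow> real" and B
    assume h: "continuous_on UNIV h" and B: "\<And>z. \<bar>h z\<bar> \<le> B"
    have [measurable]: "h \<in> borel_measurable borel"
      using h by (rule borel_measurable_continuous_onI)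
    have cont: "isCont (\<lambda>t. h (plane_curve t)) t" for t
      using continuous_on_compose2[OF h continuous_on_plane_curve] continuous_on_eq_continuous_at[of UNIV]
      by auto
    have rd: "real_distribution (((\<lambda>n. distr (measure_pmf (p n)) borel s) \<circ> r) n)" for n
      unfolding o_def by (rule prob_space.real_distribution_distr[OF measure_pmf.prob_space_axioms]) auto
    have "(\<lambda>n. integral\<^sup>L (((\<lambda>n. distr (measure_pmf (p n)) borel s) \<circ> r) n) (\<lambda>t. h (plane_curve t)))
        \<longlonglongrightarrow> integral\<^sup>L M (\<lambda>t. h (plane_curve t))"
      by (rule weak_conv_imp_integral_bdd_continuous_conv[OF rd M w cont, of B]) (use B in auto)
    \<comment> \<open>Composing with the curve undoes the lift, since
      \<open>plane_curve (s z) = z\<close>.\<close>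
    also have "(\<lambda>n. integral\<^sup>L (((\<lambda>n. distr (measure_pmf (p n)) borel s) \<circ> r) n) (\<lambda>t. h (plane_curve t)))
        = (\<lambda>n. measure_pmf.expectation (p (r n)) h)"
      by (subst o_def, subst integral_distr) (auto simp: s(1))
    also have "integral\<^sup>L M (\<lambda>t. h (plane_curve t)) = integral\<^sup>L (distr M borel plane_curve) h"
      by (subst integral_distr) auto
    finally show "(\<lambda>n. measure_pmf.expectation (p (r n)) h) \<longlonglongrightarrow> integral\<^sup>L (distr M borel plane_curve) h" .
  qed (use r in auto)
qed

subsection \<open>Lagrange multipliers\<close>

definition mix_pmf :: "real \<Rightarrow> 'a pmf \<Rightarrow> 'a pmf \<Rightarrow> 'a pmf" where
  "mix_pmf t p q = bernoulli_pmf t \<bind> (\<lambda>b. if b then q else p)"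

text \<open>Convexity, bundled with finite supports so that every real function is integrable
  against every member.\<close>

definition mix_closed :: "'a pmf set \<Rightarrow> bool" where
  "mix_closed X \<longleftrightarrow> (\<forall>p\<in>X. finite (set_pmf p)) \<and>
     (\<forall>p\<in>X. \<forall>q\<in>X. \<forall>t. 0 \<le> t \<longrightarrow> t \<le> 1 \<longrightarrow> mix_pmf t p q \<in> X)"

lemma set_mix_pmf: "set_pmf (mix_pmf t p q) \<subseteq> set_pmf p \<union> set_pmf q"
  by (auto simp: mix_pmf_def split: if_splits)

lemma expectation_mix_pmf:
  fixes h :: "'a \<Rightarrow> real"
  assumes t: "0 \<le> t" "t \<le> 1" and fin: "finite (set_pmf p)" "finite (set_pmf q)"
  shows "measure_pmf.expectation (mix_pmf t p q) h =
    (1 - t) * measure_pmf.expectation p h + t * measure_pmf.expectation q h"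
  unfolding mix_pmf_def
  by (subst pmf_expectation_bind[of UNIV]) (use t fin in \<open>auto simp: UNIV_bool\<close>)

lemma expectation_finite_diff:
  fixes h f :: "'a \<Rightarrow> real"
  assumes "finite (set_pmf p)"
  shows "measure_pmf.expectation p (\<lambda>z. h z - a * f z) =
    measure_pmf.expectation p h - a * measure_pmf.expectation p f"
  by (subst Bochner_Integration.integral_diff)
    (auto intro: integrable_measure_pmf_finite[OF assms])

text \<open>The pairs (E f, E h) form a convex planar set, and the multiplier is the slope of a line
  below it. Points with E f < 0 bound the slope from below and points with E f > 0 from above;
  \<open>cross\<close> makes the bounds compatible, and the Slater point keeps the supremum of the
  lower bounds finite.\<close>

lemma lagrange_multiplier:
  fixes h f :: "'a \<Rightarrow> real"
  assumes X: "mix_closed X" and slater: "p0 \<in> X" "measure_pmf.expectation p0 f > 0"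
    and v: "\<And>p. p \<in> X \<Longrightarrow> measure_pmf.expectation p f \<ge> 0 \<Longrightarrow> measure_pmf.expectation p h \<ge> v"
  shows "\<exists>a\<ge>0. \<forall>p\<in>X. measure_pmf.expectation p (\<lambda>z. h z - a * f z) \<ge> v"
proof -
  let ?E = "measure_pmf.expectation"
  have cross: "(v - ?E q h) / (- ?E q f) \<le> (?E p h - v) / ?E p f"
    if "p \<in> X" "q \<in> X" "?E p f > 0" "?E q f < 0" for p q
  proof -
    \<comment> \<open>The weight for which the mixture of p and q has E f = 0, so that the
      hypothesis on v applies to it.\<close>
    define t where "t = ?E p f / (?E p f - ?E q f)"
    have t: "0 \<le> t" "t \<le> 1" "(1 - t) * ?E p f + t * ?E q f = 0"
      using that by (auto simp: t_def field_simps)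
    have fin: "finite (set_pmf p)" "finite (set_pmf q)" and m: "mix_pmf t p q \<in> X"
      using X that t by (auto simp: mix_closed_def)
    have "v \<le> (1 - t) * ?E p h + t * ?E q h"
      using v[OF m] t by (simp add: expectation_mix_pmf[OF t(1,2) fin])
    moreover have "1 - t = - ?E q f / (?E p f - ?E q f)"
      using that by (simp add: t_def field_simps)
    ultimately have "v \<le> (- ?E q f * ?E p h + ?E p f * ?E q h) / (?E p f - ?E q f)"
      using that unfolding t_def by (simp add: add_divide_distrib diff_divide_distrib)
    then have "v * (?E p f - ?E q f) \<le> - ?E q f * ?E p h + ?E p f * ?E q h"
      using that by (subst (asm) pos_le_divide_eq) auto
    then show ?thesis
      using that by (simp add: divide_simps) (simp add: algebra_simps)
  qed
  \<comment> \<open>Inserting 0 makes the multiplier nonnegative; 0 respects the upper bounds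
    because E h is at least v wherever E f > 0.\<close>
  define S where "S = insert 0 ((\<lambda>q. (v - ?E q h) / (- ?E q f)) ` {q \<in> X. ?E q f < 0})"
  have ub: "y \<le> (?E p h - v) / ?E p f" if "y \<in> S" "p \<in> X" "?E p f > 0" for y p
    using that cross v[of p] by (auto simp: S_def)
  have bdd: "bdd_above S"
    unfolding bdd_above_def using ub[OF _ slater] by blast
  have "?E p (\<lambda>z. h z - Sup S * f z) \<ge> v" if p: "p \<in> X" for p
  proof -
    consider "?E p f > 0" | "?E p f = 0" | "?E p f < 0" by linarith
    then have "?E p h - Sup S * ?E p f \<ge> v"
    proof cases
      case 1
      then have "Sup S \<le> (?E p h - v) / ?E p f"
        by (intro cSup_least ub p) (auto simp: S_def)
      with 1 show ?thesis by (simp add: field_simps)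
    next
      case 2
      then show ?thesis using v[OF p] by simp
    next
      case 3
      then have "(v - ?E p h) / (- ?E p f) \<le> Sup S"
        using p by (intro cSup_upper bdd) (auto simp: S_def)
      with 3 show ?thesis by (simp add: field_simps)
    qed
    then show ?thesis
      using X p by (subst expectation_finite_diff) (auto simp: mix_closed_def)
  qed
  moreover have "Sup S \<ge> 0" by (intro cSup_upper bdd) (simp add: S_def)
  ultimately show ?thesis by blast
qed

text \<open>Induction with h arbitrary: the last constraint is dualised over the convex set Y cut
  out by the earlier ones, and its penalty is absorbed into h before those are dualised over X.
  Strictness of the Slater point puts it in every such Y.\<close>

lemma lagrange_multipliers:
  fixes h :: "'a \<Rightarrow> real" and f :: "nat \<Rightarrow> 'a \<Rightarrow> real"
  assumes X: "mix_closed X"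
    and slater: "p0 \<in> X" "\<And>i. i < N \<Longrightarrow> measure_pmf.expectation p0 (f i) > 0"
    and v: "\<And>p. p \<in> X \<Longrightarrow> (\<And>i. i < N \<Longrightarrow> measure_pmf.expectation p (f i) \<ge> 0) \<Longrightarrow>
      measure_pmf.expectation p h \<ge> v"
  shows "\<exists>a. (\<forall>i. a i \<ge> 0) \<and>
    (\<forall>p\<in>X. measure_pmf.expectation p (\<lambda>z. h z - (\<Sum>i<N. a i * f i z)) \<ge> v)"
  using slater v
proof (induction N arbitrary: h)
  case 0
  then show ?case by (intro exI[of _ "\<lambda>_. 0"]) simp
next
  case (Suc N)
  let ?E = "measure_pmf.expectation"
  define Y where "Y = {p \<in> X. \<forall>i<N. ?E p (f i) \<ge> 0}"
  have Y: "mix_closed Y"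
    using X by (auto simp: mix_closed_def Y_def expectation_mix_pmf intro!: add_nonneg_nonneg)
  have "\<exists>a\<ge>0. \<forall>p\<in>Y. ?E p (\<lambda>z. h z - a * f N z) \<ge> v"
  proof (rule lagrange_multiplier[OF Y])
    show "p0 \<in> Y" using Suc.prems(1,2) by (auto simp: Y_def less_imp_le)
    show "?E p0 (f N) > 0" using Suc.prems(2) by simp
    show "?E p h \<ge> v" if "p \<in> Y" "?E p (f N) \<ge> 0" for p
      using that by (intro Suc.prems(3)) (auto simp: Y_def less_Suc_eq)
  qed
  then obtain b where b: "b \<ge> 0" "\<And>p. p \<in> Y \<Longrightarrow> ?E p (\<lambda>z. h z - b * f N z) \<ge> v" by blast
  have "\<exists>a. (\<forall>i. a i \<ge> 0) \<and>
    (\<forall>p\<in>X. ?E p (\<lambda>z. (h z - b * f N z) - (\<Sum>i<N. a i * f i z)) \<ge> v)"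
    by (rule Suc.IH) (use Suc.prems b in \<open>auto simp: Y_def\<close>)
  then obtain a where a: "\<And>i. a i \<ge> 0"
    "\<And>p. p \<in> X \<Longrightarrow> ?E p (\<lambda>z. (h z - b * f N z) - (\<Sum>i<N. a i * f i z)) \<ge> v" by blast
  show ?case
    by (intro exI[of _ "a(N := b)"]) (use a b in \<open>auto simp: algebra_simps\<close>)
qed

subsection \<open>Mass escaping to infinity\<close>

lemma continuous_eventually_bounded:
  fixes F :: "complex \<Rightarrow> real"
  assumes F: "continuous_on UNIV F" and ev: "eventually (\<lambda>z. \<bar>F z\<bar> \<le> K) at_infinity"
  shows "\<exists>B. \<forall>z. \<bar>F z\<bar> \<le> B"
proof -
  obtain R where R: "\<And>z. R \<le> cmod z \<Longrightarrow> \<bar>F z\<bar> \<le> K"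
    using ev by (auto simp: eventually_at_infinity)
  have "compact (F ` cball 0 R)"
    by (intro compact_continuous_image continuous_on_subset[OF F]) auto
  then obtain B where B: "\<And>z. z \<in> cball 0 R \<Longrightarrow> \<bar>F z\<bar> \<le> B"
    by (meson compact_imp_bounded bounded_real imageI)
  have "\<bar>F z\<bar> \<le> max B K" for z
    using R[of z] B[of z] by (cases "cmod z \<le> R") (auto simp: le_max_iff_disj)
  then show ?thesis by blast
qed

text \<open>Writing q(z) as z^d times the reflected polynomial at 1/z, the second factor tends to
  the leading coefficient, so only a bounded term remains near infinity. The floor e removes the
  singularities at the roots and makes the function continuous.\<close>

lemma ln_max_poly_growth:
  fixes q :: "complex poly"
  assumes q: "q \<noteq> 0" and e: "e > 0"
  shows "\<exists>B. \<forall>z. \<bar>ln (max (cmod (poly q z)) e) - real (degree q) * log_plus z\<bar> \<le> B"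
proof (rule continuous_eventually_bounded)
  show "continuous_on UNIV (\<lambda>z. ln (max (cmod (poly q z)) e) - real (degree q) * log_plus z)"
    using e by (intro continuous_intros continuous_on_log_plus) (auto simp: max_def)
  define l where "l = cmod (lead_coeff q)"
  have l: "l > 0" using q by (simp add: l_def)
  have "((\<lambda>z. poly (reflect_poly q) (inverse z)) \<longlongrightarrow> poly (reflect_poly q) 0) at_infinity"
    by (intro tendsto_intros tendsto_inverse_0)
  then have "((\<lambda>z. cmod (poly (reflect_poly q) (inverse z))) \<longlongrightarrow> l) at_infinity"
    unfolding l_def by (intro tendsto_norm) simp
  then have "\<forall>\<^sub>F z in at_infinity. dist (cmod (poly (reflect_poly q) (inverse z))) l < l / 2"
    using l by (intro tendstoD) auto
  moreover have "\<forall>\<^sub>F z::complex in at_infinity. 1 \<le> cmod z"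
    by (auto simp: eventually_at_infinity)
  ultimately show "\<forall>\<^sub>F z in at_infinity.
      \<bar>ln (max (cmod (poly q z)) e) - real (degree q) * log_plus z\<bar> \<le> \<bar>ln (l/2)\<bar> + \<bar>ln (max (2*l) e)\<bar>"
  proof eventually_elim
    case (elim z)
    define \<rho> where "\<rho> = cmod (poly (reflect_poly q) (inverse z))"
    define w where "w = cmod z ^ degree q"
    have \<rho>: "l / 2 \<le> \<rho>" "\<rho> \<le> 2 * l"
      using elim(1) by (auto simp: \<rho>_def dist_real_def abs_if split: if_splits)
    have w: "1 \<le> w" unfolding w_def using elim(2) by (rule one_le_power)
    have z: "z \<noteq> 0" using elim(2) by auto
    have "poly q z = z ^ degree q * poly (reflect_poly q) (inverse z)"
      using z by (subst poly_reflect_poly_nz) (auto simp: power_inverse)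
    then have qz: "cmod (poly q z) = w * \<rho>"
      by (simp add: \<rho>_def w_def norm_mult norm_power)
    have lw: "real (degree q) * log_plus z = ln w"
      using elim(2) z by (simp add: w_def log_plus_def ln_realpow)
    have "w * \<rho> \<le> max (w * \<rho>) e" "max (w * \<rho>) e \<le> w * max (2 * l) e"
      using \<rho> w e l by (auto simp: max_def intro: mult_left_mono order_trans mult_right_mono
        intro!: mult_left_mono order_trans[OF _ mult_right_mono[OF w]])
    then have "ln (w * \<rho>) \<le> ln (max (w * \<rho>) e)" "ln (max (w * \<rho>) e) \<le> ln (w * max (2 * l) e)"
      using \<rho> w e l by (auto intro!: ln_mono mult_pos_pos simp: less_max_iff_disj)
    moreover have "ln (w * \<rho>) = ln w + ln \<rho>" "ln (w * max (2 * l) e) = ln w + ln (max (2 * l) e)"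
      using \<rho> w e l by (auto intro!: ln_mult_pos simp: less_max_iff_disj)
    moreover have "ln (l / 2) \<le> ln \<rho>"
      using \<rho> l by (intro ln_mono) auto
    ultimately show ?case unfolding qz lw by linarith
  qed
qed

lemma growth_log_plus:
  fixes g :: "complex \<Rightarrow> real"
  assumes cont: "continuous_on UNIV g"
    and growth: "(\<lambda>z. g z - ln (cmod z)) \<in> o[at_infinity](\<lambda>z. ln (cmod z))"
    and "\<epsilon> > 0"
  shows "\<exists>B. \<forall>z. \<bar>g z - log_plus z\<bar> \<le> \<epsilon> * log_plus z + B"
proof -
  \<comment> \<open>The excess over the allowed error, clipped at 0: it vanishes near infinity by
    the little-o hypothesis and is bounded on the remaining compact disc.\<close>
  let ?F = "\<lambda>z. max 0 (\<bar>g z - log_plus z\<bar> - \<epsilon> * log_plus z)"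
  have "\<exists>B. \<forall>z. \<bar>?F z\<bar> \<le> B"
  proof (rule continuous_eventually_bounded)
    show "continuous_on UNIV ?F"
      by (intro continuous_intros cont continuous_on_log_plus)
    have "\<forall>\<^sub>F z in at_infinity. norm (g z - ln (cmod z)) \<le> \<epsilon> * norm (ln (cmod z))"
      using landau_o.smallD[OF growth \<open>\<epsilon> > 0\<close>] .
    moreover have "\<forall>\<^sub>F z::complex in at_infinity. 1 \<le> cmod z"
      by (auto simp: eventually_at_infinity)
    ultimately show "\<forall>\<^sub>F z in at_infinity. \<bar>?F z\<bar> \<le> 0"
      by eventually_elim (simp add: log_plus_def)
  qed
  then obtain B where "\<And>z. \<bar>?F z\<bar> \<le> B" by blast
  then have "\<bar>g z - log_plus z\<bar> \<le> \<epsilon> * log_plus z + B" for z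
    by (smt (verit))
  then show ?thesis by blast
qed

lemma integrable_log_growth:
  fixes h :: "complex \<Rightarrow> real"
  assumes "prob_space \<mu>" and sets: "sets \<mu> = sets borel" and lp: "integrable \<mu> log_plus"
    and h: "h \<in> borel_measurable borel" and B: "\<And>z. \<bar>h z - \<kappa> * log_plus z\<bar> \<le> \<epsilon> * log_plus z + B"
  shows "integrable \<mu> h"
proof -
  interpret prob_space \<mu> by fact
  have [measurable]: "h \<in> borel_measurable \<mu>"
    using h by (simp add: measurable_cong_sets[OF sets refl])
  show ?thesis
  proof (rule Bochner_Integration.integrable_bound)
    show "integrable \<mu> (\<lambda>z. (\<bar>\<kappa>\<bar> + \<epsilon>) * log_plus z + B)"
      using lp by simp
    have "\<bar>h z\<bar> \<le> (\<bar>\<kappa>\<bar> + \<epsilon>) * log_plus z + B" for z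
    proof -
      have "\<bar>h z\<bar> \<le> \<bar>\<kappa> * log_plus z\<bar> + \<bar>h z - \<kappa> * log_plus z\<bar>" by linarith
      also have "\<bar>\<kappa> * log_plus z\<bar> = \<bar>\<kappa>\<bar> * log_plus z"
        by (simp add: abs_mult log_plus_nonneg)
      finally show ?thesis using B[of z] by (simp add: algebra_simps)
    qed
    then show "AE z in \<mu>. norm (h z) \<le> norm ((\<bar>\<kappa>\<bar> + \<epsilon>) * log_plus z + B)"
      by (auto intro!: AE_I2 order_trans[OF _ abs_ge_self])
  qed fact
qed

text \<open>The limit L is a separate datum because \<open>log_plus\<close> is unbounded and weak
  convergence does not determine it. Its excess over the integral of \<open>log_plus\<close> against
  \<mu> is the escaped amount c.\<close>

locale log_escape =
  fixes p :: "nat \<Rightarrow> complex pmf" and \<mu> :: "complex measure" and L :: real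
  assumes fin: "\<And>n. finite (set_pmf (p n))"
    and prob: "prob_space \<mu>" and sets_mu: "sets \<mu> = sets borel"
    and weak: "\<And>(h :: complex \<Rightarrow> real) B. continuous_on UNIV h \<Longrightarrow> (\<And>z. \<bar>h z\<bar> \<le> B) \<Longrightarrow>
       (\<lambda>n. measure_pmf.expectation (p n) h) \<longlonglongrightarrow> integral\<^sup>L \<mu> h"
    and lim: "(\<lambda>n. measure_pmf.expectation (p n) log_plus) \<longlonglongrightarrow> L"
begin

lemma mono_expect:
  fixes f h :: "complex \<Rightarrow> real"
  assumes "\<And>z. z \<in> set_pmf (p n) \<Longrightarrow> f z \<le> h z"
  shows "measure_pmf.expectation (p n) f \<le> measure_pmf.expectation (p n) h"
  by (intro integral_mono_AE integrable_measure_pmf_finite[OF fin])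
    (use assms in \<open>auto simp: AE_measure_pmf_iff\<close>)

lemma measurable_mu: "h \<in> borel_measurable borel \<Longrightarrow> h \<in> borel_measurable \<mu>"
  by (simp add: measurable_cong_sets[OF sets_mu refl])

text \<open>A Fatou argument: the truncations are bounded and continuous, so weak convergence bounds
  their integrals by L, and monotone convergence removes the truncation.\<close>

lemma log_plus_limit: "integrable \<mu> log_plus \<and> integral\<^sup>L \<mu> log_plus \<le> L"
proof -
  interpret prob_space \<mu> by (rule prob)
  let ?f = "\<lambda>k z. min (log_plus z) (real k)"
  have cont: "continuous_on UNIV (?f k)" for k
    by (intro continuous_intros continuous_on_log_plus)
  have m: "?f k \<in> borel_measurable \<mu>" for k
    by (intro measurable_mu borel_measurable_continuous_onI cont)
  have int: "integrable \<mu> (?f k)" for k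
    by (rule integrable_const_bound[of _ "real k"]) (use m log_plus_nonneg in auto)
  have le: "integral\<^sup>L \<mu> (?f k) \<le> L" for k
  proof (rule LIMSEQ_le[OF weak[of _ "real k"] lim])
    show "\<exists>N. \<forall>n\<ge>N. measure_pmf.expectation (p n) (?f k) \<le> measure_pmf.expectation (p n) log_plus"
      by (intro exI allI impI mono_expect) auto
  qed (use cont log_plus_nonneg in auto)
  have inc: "incseq (\<lambda>k. integral\<^sup>L \<mu> (?f k))"
    by (intro incseq_SucI integral_mono int) auto
  obtain x where x: "(\<lambda>k. integral\<^sup>L \<mu> (?f k)) \<longlonglongrightarrow> x"
    using incseq_convergent[OF inc, of L] le by blast
  have pw: "(\<lambda>k. ?f k z) \<longlonglongrightarrow> log_plus z" for z
  proof (rule tendsto_eventually)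
    show "\<forall>\<^sub>F k in sequentially. ?f k z = log_plus z"
      using eventually_ge_at_top[of "nat \<lceil>log_plus z\<rceil>"]
      by eventually_elim (simp add: nat_le_iff ceiling_le_iff min_def)
  qed
  have mono: "mono (\<lambda>k. ?f k z)" for z
    by (auto simp: mono_def)
  have "integrable \<mu> log_plus" "integral\<^sup>L \<mu> log_plus = x"
    using integrable_monotone_convergence[OF int _ _ x measurable_mu[OF borel_measurable_log_plus]]
      integral_monotone_convergence[OF int _ _ x measurable_mu[OF borel_measurable_log_plus]] pw mono
    by auto
  moreover have "x \<le> L"
    using LIMSEQ_le_const2[OF x] le by blast
  ultimately show ?thesis by simp
qed

text \<open>Bounded logarithmic moments make functions of growth o(log) uniformly integrable, so
  none of their integral escapes.\<close>

lemma limit_of_sublog: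
  fixes h :: "complex \<Rightarrow> real"
  assumes h: "continuous_on UNIV h"
    and bd: "\<And>\<epsilon>. \<epsilon> > 0 \<Longrightarrow> \<exists>B. \<forall>z. \<bar>h z\<bar> \<le> \<epsilon> * log_plus z + B"
  shows "(\<lambda>n. measure_pmf.expectation (p n) h) \<longlonglongrightarrow> integral\<^sup>L \<mu> h"
proof (rule LIMSEQ_I)
  interpret prob_space \<mu> by (rule prob)
  fix e :: real assume e: "e > 0"
  have lp: "integrable \<mu> log_plus" "integral\<^sup>L \<mu> log_plus \<le> L" using log_plus_limit by auto
  have "0 \<le> integral\<^sup>L \<mu> log_plus" by (rule Bochner_Integration.integral_nonneg) (rule log_plus_nonneg)
  then have L: "L \<ge> 0" using lp by linarith
  define \<epsilon> where "\<epsilon> = e / (3 * (L + 1))"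
  have \<epsilon>: "\<epsilon> > 0" "\<epsilon> * (L + 1) = e / 3" using e L by (auto simp: \<epsilon>_def field_simps)
  obtain B where B: "\<And>z. \<bar>h z\<bar> \<le> \<epsilon> * log_plus z + B" using bd[OF \<epsilon>(1)] by blast
  \<comment> \<open>Clipping at the additive constant B costs at most
    \<open>\<epsilon> * log_plus\<close>, hence e/3 under \<mu> and e/3 under p n for large n; weak
    convergence of the clipped function accounts for the last third.\<close>
  define k where "k z = max (- \<bar>B\<bar>) (min \<bar>B\<bar> (h z))" for z
  have kc: "continuous_on UNIV k" unfolding k_def by (intro continuous_intros h)
  have kb: "\<bar>k z\<bar> \<le> \<bar>B\<bar>" for z by (auto simp: k_def)
  have diff: "\<bar>h z - k z\<bar> \<le> \<epsilon> * log_plus z" for z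
    using B[of z] mult_nonneg_nonneg[OF less_imp_le[OF \<epsilon>(1)] log_plus_nonneg[of z]]
    by (auto simp: k_def max_def min_def)
  have hi: "integrable \<mu> h"
    by (rule integrable_log_growth[OF prob sets_mu lp(1) borel_measurable_continuous_onI[OF h], of 0 \<epsilon> B])
       (use B in auto)
  have ki: "integrable \<mu> k"
    by (rule integrable_const_bound[of _ "\<bar>B\<bar>"])
       (use kb measurable_mu[OF borel_measurable_continuous_onI[OF kc]] in auto)
  have "\<bar>integral\<^sup>L \<mu> h - integral\<^sup>L \<mu> k\<bar> \<le> integral\<^sup>L \<mu> (\<lambda>z. \<epsilon> * log_plus z)"
  proof -
    have "\<bar>integral\<^sup>L \<mu> h - integral\<^sup>L \<mu> k\<bar> = \<bar>integral\<^sup>L \<mu> (\<lambda>z. h z - k z)\<bar>"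
      using hi ki by simp
    also have "\<dots> \<le> integral\<^sup>L \<mu> (\<lambda>z. \<bar>h z - k z\<bar>)" by (rule integral_abs_bound)
    also have "\<dots> \<le> integral\<^sup>L \<mu> (\<lambda>z. \<epsilon> * log_plus z)"
      by (intro integral_mono) (use hi ki lp diff in auto)
    finally show ?thesis .
  qed
  also have "\<dots> \<le> \<epsilon> * (L + 1)" using lp \<epsilon> by (simp add: mult_left_mono)
  finally have d1: "\<bar>integral\<^sup>L \<mu> h - integral\<^sup>L \<mu> k\<bar> \<le> e / 3" using \<epsilon> by simp
  have ev1: "\<forall>\<^sub>F n in sequentially. measure_pmf.expectation (p n) log_plus < L + 1"
    using lim by (rule order_tendstoD) simp
  have ev2: "\<forall>\<^sub>F n in sequentially. dist (measure_pmf.expectation (p n) k) (integral\<^sup>L \<mu> k) < e / 3"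
    using weak[OF kc kb] e by (intro tendstoD) auto
  have "\<forall>\<^sub>F n in sequentially. norm (measure_pmf.expectation (p n) h - integral\<^sup>L \<mu> h) < e"
    using ev1 ev2
  proof eventually_elim
    case (elim n)
    let ?E = "measure_pmf.expectation (p n)"
    have int: "integrable (measure_pmf (p n)) f" for f :: "complex \<Rightarrow> real"
      by (rule integrable_measure_pmf_finite[OF fin])
    have "\<bar>?E h - ?E k\<bar> = \<bar>?E (\<lambda>z. h z - k z)\<bar>"
      using int by simp
    also have "\<dots> \<le> ?E (\<lambda>z. \<bar>h z - k z\<bar>)" by (rule integral_abs_bound)
    also have "\<dots> \<le> ?E (\<lambda>z. \<epsilon> * log_plus z)" by (rule mono_expect) (rule diff)
    also have "\<dots> \<le> \<epsilon> * (L + 1)" using elim(1) \<epsilon> by (simp add: mult_left_mono)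
    finally have "\<bar>?E h - ?E k\<bar> \<le> e / 3" using \<epsilon> by simp
    with d1 elim(2) show ?case unfolding dist_real_def real_norm_def by linarith
  qed
  then show "\<exists>no. \<forall>n\<ge>no. norm (measure_pmf.expectation (p n) h - integral\<^sup>L \<mu> h) < e"
    by (simp add: eventually_sequentially)
qed

text \<open>The mass escaping to infinity contributes \<open>L - \<integral> log_plus d\<mu>\<close> per unit of
  logarithmic growth.\<close>

lemma limit_of_log_growth:
  fixes h :: "complex \<Rightarrow> real"
  assumes h: "continuous_on UNIV h"
    and bd: "\<And>\<epsilon>. \<epsilon> > 0 \<Longrightarrow> \<exists>B. \<forall>z. \<bar>h z - \<kappa> * log_plus z\<bar> \<le> \<epsilon> * log_plus z + B"
  shows "integrable \<mu> h \<and> (\<lambda>n. measure_pmf.expectation (p n) h) \<longlonglongrightarrow>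
    integral\<^sup>L \<mu> h + \<kappa> * (L - integral\<^sup>L \<mu> log_plus)"
proof
  have lp: "integrable \<mu> log_plus" using log_plus_limit by simp
  obtain B where "\<And>z. \<bar>h z - \<kappa> * log_plus z\<bar> \<le> 1 * log_plus z + B"
    using bd[of 1] by auto
  then show hi: "integrable \<mu> h"
    by (rule integrable_log_growth[OF prob sets_mu lp borel_measurable_continuous_onI[OF h]])
  \<comment> \<open>The sublogarithmic remainder passes to the limit, and the multiple of
    \<open>log_plus\<close> converges by the definition of L.\<close>
  have "(\<lambda>n. measure_pmf.expectation (p n) (\<lambda>z. h z - \<kappa> * log_plus z)
        + \<kappa> * measure_pmf.expectation (p n) log_plus)
      \<longlonglongrightarrow> integral\<^sup>L \<mu> (\<lambda>z. h z - \<kappa> * log_plus z) + \<kappa> * L"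
    by (intro tendsto_intros lim limit_of_sublog bd continuous_intros h continuous_on_log_plus)
  moreover have "measure_pmf.expectation (p n) (\<lambda>z. h z - \<kappa> * log_plus z)
        + \<kappa> * measure_pmf.expectation (p n) log_plus = measure_pmf.expectation (p n) h" for n
    by (subst Bochner_Integration.integral_diff)
      (auto intro: integrable_measure_pmf_finite[OF fin])
  moreover have "integral\<^sup>L \<mu> (\<lambda>z. h z - \<kappa> * log_plus z) = integral\<^sup>L \<mu> h - \<kappa> * integral\<^sup>L \<mu> log_plus"
    using hi lp by simp
  ultimately show "(\<lambda>n. measure_pmf.expectation (p n) h) \<longlonglongrightarrow>
    integral\<^sup>L \<mu> h + \<kappa> * (L - integral\<^sup>L \<mu> log_plus)"
    by (simp add: algebra_simps)
qed

end

section \<open>Positive and negative parts of log |q|\<close>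

lemma borel_measurable_elog [measurable]: "elog \<in> borel_measurable borel"
  unfolding elog_def[abs_def] by measurable

lemma borel_measurable_poly [measurable]: "(\<lambda>z. poly q z) \<in> borel_measurable borel"
  for q :: "complex poly"
  by (intro borel_measurable_continuous_onI continuous_intros)

lemma e2ennreal_elog: "x \<ge> 0 \<Longrightarrow> e2ennreal (elog x) = ennreal (ln (max 1 x))"
  by (cases "x \<ge> 1") (auto simp: elog_def e2ennreal_neg max_def ennreal_neg)

lemma e2ennreal_minus_elog: "e2ennreal (- elog x) = (if x = 0 then \<infinity> else ennreal (- ln x))"
  by (auto simp: elog_def)

definition log_pos :: "complex poly \<Rightarrow> complex \<Rightarrow> ennreal" where
  "log_pos q z = e2ennreal (elog (cmod (poly q z)))"

text \<open>Infinite at the roots of q. With both parts in \<open>ennreal\<close>, a constraint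
  becomes a comparison of two nonnegative integrals, without subtraction.\<close>

definition log_neg :: "complex poly \<Rightarrow> complex \<Rightarrow> ennreal" where
  "log_neg q z = e2ennreal (- elog (cmod (poly q z)))"

lemma measurable_log_pos_neg [measurable]:
  "log_pos q \<in> borel_measurable borel" "log_neg q \<in> borel_measurable borel"
  unfolding log_pos_def[abs_def] log_neg_def[abs_def] by measurable

lemma nn_integral_log_pos_finite:
  assumes "prob_space \<mu>" and sets: "sets \<mu> = sets borel" and lp: "integrable \<mu> log_plus"
  shows "(\<integral>\<^sup>+ z. log_pos q z \<partial>\<mu>) < \<infinity>"
proof (cases "q = 0")
  case True
  then show ?thesis by (simp add: log_pos_def e2ennreal_elog)
next
  case False
  interpret prob_space \<mu> by fact
  obtain B where B: "\<And>z. \<bar>ln (max (cmod (poly q z)) 1) - real (degree q) * log_plus z\<bar> \<le> B"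
    using ln_max_poly_growth[OF False, of 1] by auto
  have int: "integrable \<mu> (\<lambda>z. real (degree q) * log_plus z + B)"
    using lp by simp
  have nn: "0 \<le> real (degree q) * log_plus z + B" for z
    using B[of z] ln_ge_zero[of "max (cmod (poly q z)) 1"] by linarith
  have "(\<integral>\<^sup>+ z. log_pos q z \<partial>\<mu>) \<le> (\<integral>\<^sup>+ z. ennreal (real (degree q) * log_plus z + B) \<partial>\<mu>)"
  proof (intro nn_integral_mono)
    fix z show "log_pos q z \<le> ennreal (real (degree q) * log_plus z + B)"
      using B[of z] by (auto simp: log_pos_def e2ennreal_elog max.commute intro!: ennreal_leI)
  qed
  also have "\<dots> = ennreal (integral\<^sup>L \<mu> (\<lambda>z. real (degree q) * log_plus z + B))"
    by (rule nn_integral_eq_integral[OF int]) (use nn in auto)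
  also have "\<dots> < \<infinity>" by simp
  finally show ?thesis .
qed

text \<open>Upper semicontinuity: max (log |q|) (-M) is continuous of logarithmic growth and
  dominates log |q|, so its integral plus the escape term is nonnegative. Monotone convergence in M
  then recovers the negative part.\<close>

lemma (in log_escape) log_neg_limit:
  assumes q: "q \<noteq> 0"
    and ev: "\<forall>\<^sub>F n in sequentially. (\<forall>z\<in>set_pmf (p n). poly q z \<noteq> 0) \<and>
       measure_pmf.expectation (p n) (\<lambda>z. ln (cmod (poly q z))) \<ge> 0"
  shows "(\<integral>\<^sup>+ z. log_neg q z \<partial>\<mu>) \<le>
    (\<integral>\<^sup>+ z. log_pos q z \<partial>\<mu>) + ennreal (real (degree q) * (L - integral\<^sup>L \<mu> log_plus))"
proof -
  let ?c = "real (degree q) * (L - integral\<^sup>L \<mu> log_plus)"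
  have c: "?c \<ge> 0" using log_plus_limit by simp
  define f where "f M z = ln (max (cmod (poly q z)) (exp (- real M)))" for M z
  have fc: "continuous_on UNIV (f M)" for M
    unfolding f_def by (intro continuous_intros) (auto simp: max_def)
  have gr: "\<exists>B. \<forall>z. \<bar>f M z - real (degree q) * log_plus z\<bar> \<le> \<epsilon> * log_plus z + B"
    if "\<epsilon> > 0" for \<epsilon> M
  proof -
    obtain B where "\<And>z. \<bar>f M z - real (degree q) * log_plus z\<bar> \<le> B"
      unfolding f_def using ln_max_poly_growth[OF q, of "exp (- real M)"] by auto
    then show ?thesis using that
      by (intro exI[of _ B]) (auto intro: add_increasing simp: log_plus_nonneg)
  qed
  have fi: "integrable \<mu> (f M)" and fl: "(\<lambda>n. measure_pmf.expectation (p n) (f M)) \<longlonglongrightarrow>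
    integral\<^sup>L \<mu> (f M) + ?c" for M
    using limit_of_log_growth[OF fc gr, of M] by auto
  have ge: "0 \<le> integral\<^sup>L \<mu> (f M) + ?c" for M
  proof (rule tendsto_lowerbound[OF fl])
    show "\<forall>\<^sub>F n in sequentially. 0 \<le> measure_pmf.expectation (p n) (f M)"
      using ev
    proof eventually_elim
      case (elim n)
      \<comment> \<open>Truncation only raises the logarithm because the support avoids the roots;
        the default value \<open>ln 0 = 0\<close> would lie above the truncated value -M.\<close>
      then have "measure_pmf.expectation (p n) (\<lambda>z. ln (cmod (poly q z)))
        \<le> measure_pmf.expectation (p n) (f M)"
        by (intro mono_expect) (auto simp: f_def intro!: ln_mono)
      with elim show ?case by linarith
    qed
  qed simp
  have dec: "f (Suc M) z \<le> f M z" for M z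
    unfolding f_def by (intro ln_mono max.mono) (auto simp: less_max_iff_disj)
  have f0: "f M z \<le> f 0 z" for M z
    by (induction M) (use dec order_trans in blast)+
  have pos: "log_pos q z = ennreal (f 0 z)" "f 0 z \<ge> 0" for z
    by (auto simp: log_pos_def f_def e2ennreal_elog max.commute)
  have "(\<integral>\<^sup>+ z. log_neg q z \<partial>\<mu>) \<le> (\<integral>\<^sup>+ z. (SUP M. ennreal (f 0 z - f M z)) \<partial>\<mu>)"
  proof (rule nn_integral_mono)
    fix z
    show "log_neg q z \<le> (SUP M. ennreal (f 0 z - f M z))"
    proof (cases "poly q z = 0")
      case True
      \<comment> \<open>At a root f 0 is 0 and f M is -M, so the supremum is infinite, as
        \<open>log_neg\<close> is.\<close>
      then have "(SUP M. ennreal (f 0 z - f M z)) = (SUP M. of_nat M)"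
        by (simp add: f_def ennreal_of_nat_eq_real_of_nat)
      also have "\<dots> = \<infinity>" by (simp add: ennreal_SUP_of_nat_eq_top)
      finally show ?thesis by (simp only: infinity_ennreal_def top_greatest)
    next
      case False
      obtain M where M: "real M \<ge> - ln (cmod (poly q z))"
        using real_arch_simple by blast
      have "exp (- real M) \<le> cmod (poly q z)"
        using M False by (subst ln_ge_iff[symmetric]) auto
      then have "f M z = ln (cmod (poly q z))" by (simp add: f_def)
      then have "log_neg q z \<le> ennreal (f 0 z - f M z)"
        using False pos(2)[of z] by (auto simp: log_neg_def e2ennreal_minus_elog intro!: ennreal_leI)
      also have "\<dots> \<le> (SUP M. ennreal (f 0 z - f M z))" by (rule SUP_upper) simp
      finally show ?thesis .
    qed
  qed
  also have "\<dots> = (SUP M. \<integral>\<^sup>+ z. ennreal (f 0 z - f M z) \<partial>\<mu>)"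
    by (rule nn_integral_monotone_convergence_SUP)
      (use fi dec in \<open>auto intro!: incseq_SucI ennreal_leI le_funI diff_left_mono\<close>)
  also have "\<dots> \<le> (\<integral>\<^sup>+ z. log_pos q z \<partial>\<mu>) + ennreal ?c"
  proof (rule SUP_least)
    fix M
    have "(\<integral>\<^sup>+ z. ennreal (f 0 z - f M z) \<partial>\<mu>) = ennreal (integral\<^sup>L \<mu> (\<lambda>z. f 0 z - f M z))"
      by (rule nn_integral_eq_integral) (use fi f0 in auto)
    also have "\<dots> \<le> ennreal (integral\<^sup>L \<mu> (f 0) + ?c)"
      using fi ge[of M] by (intro ennreal_leI) simp
    also have "\<dots> = ennreal (integral\<^sup>L \<mu> (f 0)) + ennreal ?c"
      by (intro ennreal_plus c Bochner_Integration.integral_nonneg pos)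
    also have "ennreal (integral\<^sup>L \<mu> (f 0)) = (\<integral>\<^sup>+ z. log_pos q z \<partial>\<mu>)"
      unfolding pos(1) by (rule nn_integral_eq_integral[symmetric]) (use fi pos in auto)
    finally show "(\<integral>\<^sup>+ z. ennreal (f 0 z - f M z) \<partial>\<mu>) \<le> (\<integral>\<^sup>+ z. log_pos q z \<partial>\<mu>) + ennreal ?c" .
  qed
  finally show ?thesis .
qed

subsection \<open>The uniform measure on a segment\<close>

text \<open>A layer-cake bound: -ln |y| is at most the number of k with |y| at most exp(-k). Those
  intervals have length 2 exp(-k), which is at most 2 / 2^k, and the geometric series gives
  4.\<close>

lemma nn_integral_minus_ln_abs: "(\<integral>\<^sup>+ y. ennreal (- ln \<bar>y\<bar>) \<partial>lborel) \<le> 4"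
proof -
  define A where "A k = {- exp (- real k)..exp (- real k)}" for k
  have "(\<integral>\<^sup>+ y. ennreal (- ln \<bar>y\<bar>) \<partial>lborel) \<le> (\<integral>\<^sup>+ y. (\<Sum>k. indicator (A k) y) \<partial>lborel)"
  proof (rule nn_integral_mono)
    fix y :: real
    show "ennreal (- ln \<bar>y\<bar>) \<le> (\<Sum>k. indicator (A k) y)"
    proof (cases "ln \<bar>y\<bar> < 0")
      case False
      then show ?thesis by (simp add: ennreal_neg)
    next
      case True
      then have y: "y \<noteq> 0" by auto
      \<comment> \<open>The point lies in the n + 1 sets A 0, ..., A n, which suffices since -ln |y|
        is at most n + 1.\<close>
      define n where "n = nat \<lfloor>- ln \<bar>y\<bar>\<rfloor>"
      have n: "real n \<le> - ln \<bar>y\<bar>" "- ln \<bar>y\<bar> \<le> real (Suc n)"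
        using True by (auto simp: n_def) linarith+
      have "y \<in> A k" if "k < Suc n" for k
      proof -
        have "ln \<bar>y\<bar> \<le> - real k" using n that by linarith
        then have "exp (ln \<bar>y\<bar>) \<le> exp (- real k)" by simp
        then show ?thesis using y by (simp add: A_def abs_le_iff)
      qed
      then have "(\<Sum>k<Suc n. indicator (A k) y) = (\<Sum>k<Suc n. 1::ennreal)"
        by (intro sum.cong) auto
      then have "ennreal (real (Suc n)) = (\<Sum>k<Suc n. indicator (A k) y)"
        by (simp add: ennreal_of_nat_eq_real_of_nat[symmetric] del: of_nat_Suc sum.lessThan_Suc)
      also have "\<dots> \<le> (\<Sum>k. indicator (A k) y)" by (rule sum_le_suminf) auto
      finally show ?thesis using n(2) by (meson ennreal_leI order_trans)
    qed
  qed
  also have "\<dots> = (\<Sum>k. \<integral>\<^sup>+ y. indicator (A k) y \<partial>lborel)"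
    by (rule nn_integral_suminf) (simp add: A_def)
  also have "\<dots> = (\<Sum>k. ennreal (2 * exp (- real k)))"
    by (intro suminf_cong) (simp add: A_def)
  also have "\<dots> \<le> (\<Sum>k. ennreal (2 * (1/2) ^ k))"
  proof (rule suminf_le)
    fix k
    have "exp (1::real) \<ge> 2" using exp_ge_add_one_self[of 1] by simp
    then have "exp (- 1::real) \<le> 1 / 2" by (simp add: exp_minus field_simps)
    then have "exp (- 1::real) ^ k \<le> (1/2) ^ k" by (rule power_mono) simp
    then show "ennreal (2 * exp (- real k)) \<le> ennreal (2 * (1/2) ^ k)"
      by (intro ennreal_leI) (simp add: exp_of_nat_mult[symmetric])
  qed auto
  also have "\<dots> = ennreal (\<Sum>k. 2 * (1/2) ^ k)"
    by (rule suminf_ennreal2) (auto intro!: summable_mult summable_geometric)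
  also have "(\<Sum>k. 2 * (1/2::real) ^ k) = 4"
    by (subst suminf_mult) (simp_all add: suminf_geometric summable_geometric)
  finally show ?thesis by simp
qed

lemma nn_integral_minus_ln_scaled:
  assumes "R > 0"
  shows "(\<integral>\<^sup>+ x. ennreal (- ln (\<bar>x - a\<bar> / R)) \<partial>lborel) \<le> ennreal (4 * R)"
proof -
  have "(\<integral>\<^sup>+ x. ennreal (- ln (\<bar>x - a\<bar> / R)) \<partial>lborel)
      = \<bar>R\<bar> * (\<integral>\<^sup>+ y. ennreal (- ln (\<bar>(a + R * y) - a\<bar> / R)) \<partial>lborel)"
    using assms by (intro nn_integral_real_affine) auto
  also have "\<dots> = ennreal R * (\<integral>\<^sup>+ y. ennreal (- ln \<bar>y\<bar>) \<partial>lborel)"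
    using assms by (simp add: abs_mult)
  also have "\<dots> \<le> ennreal R * 4"
    by (intro mult_left_mono nn_integral_minus_ln_abs) simp
  also have "\<dots> = ennreal (4 * R)"
    using assms by (subst ennreal_numeral[symmetric]) (simp add: ennreal_mult' mult.commute del: ennreal_numeral)
  finally show ?thesis .
qed

text \<open>On a real segment the logarithmic potential reduces to a one-variable integral, and
  translation invariance removes the dependence on the root.\<close>

definition segment_measure :: "real \<Rightarrow> complex measure" where
  "segment_measure R = distr (uniform_measure lborel {0..R}) borel complex_of_real"

lemma prob_space_segment_measure: "R > 0 \<Longrightarrow> prob_space (segment_measure R)"
  unfolding segment_measure_def
  by (intro prob_space.prob_space_distr prob_space_uniform_measure) auto

lemma sets_segment_measure [simp]: "sets (segment_measure R) = sets borel"
  by (simp add: segment_measure_def)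

lemma nn_integral_segment_measure:
  assumes "R > 0" "f \<in> borel_measurable borel"
  shows "(\<integral>\<^sup>+ z. f z \<partial>segment_measure R) =
    (\<integral>\<^sup>+ x. f (complex_of_real x) * indicator {0..R} x \<partial>lborel) / ennreal R"
  using assms unfolding segment_measure_def
  by (simp add: nn_integral_distr nn_integral_uniform_measure)

lemma AE_segment_measure:
  assumes "R > 0" "finite A"
  shows "AE z in segment_measure R. z \<notin> A"
proof -
  have "AE x in uniform_measure lborel {0..R}. complex_of_real x \<notin> A"
  proof (rule AE_uniform_measureI)
    have "finite (Re ` A)" using assms by simp
    then have "AE x in lborel. x \<notin> Re ` A"
      by (intro AE_not_in finite_imp_null_set_lborel)
    then show "AE x in lborel. x \<in> {0..R} \<longrightarrow> complex_of_real x \<notin> A"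
      by eventually_elim (metis Re_complex_of_real imageI)
  qed simp
  then show ?thesis
    unfolding segment_measure_def
    by (subst AE_distr_iff) (use assms in \<open>auto simp: Compl_eq[symmetric] finite_imp_closed\<close>)
qed

text \<open>Replacing the roots by their real parts only decreases the logarithms, so the logarithmic
  potential of the segment is bounded below uniformly in the location of the roots.\<close>

lemma segment_measure_log_poly:
  assumes R: "ln R \<ge> 4" "R > 0" and q: "cmod (lead_coeff q) \<ge> 1"
  shows "(\<integral>\<^sup>+ z. log_neg q z \<partial>segment_measure R) + ennreal (real (degree q) * (ln R - 4)) \<le>
    (\<integral>\<^sup>+ z. log_pos q z \<partial>segment_measure R)"
proof -
  interpret prob_space "segment_measure R" by (rule prob_space_segment_measure) fact
  let ?S = "segment_measure R" and ?d = "degree q"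
  have q0: "q \<noteq> 0" using q by auto
  have "0 \<le> ln R" using R(1) by linarith
  then have dR: "0 \<le> real ?d * ln R" by (rule mult_nonneg_nonneg[OF of_nat_0_le_iff])
  obtain root where root: "smult (lead_coeff q) (\<Prod>i<?d. [:- root i, 1:]) = q"
    using complex_poly_decompose' by blast
  \<comment> \<open>The shortfall of log |Re z - Re (root i)| below log R. Its mean is at most 4R /
    R, whence the 4 in the bound.\<close>
  define u where "u i z = ennreal (- ln (\<bar>Re z - Re (root i)\<bar> / R))" for i and z :: complex
  have [measurable]: "u i \<in> borel_measurable borel" for i
    unfolding u_def[abs_def] by measurable
  have ui: "(\<integral>\<^sup>+ z. u i z \<partial>?S) \<le> 4" for i
  proof -
    have "(\<integral>\<^sup>+ z. u i z \<partial>?S) = (\<integral>\<^sup>+ x. u i (complex_of_real x) * indicator {0..R} x \<partial>lborel) / ennreal R"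
      by (rule nn_integral_segment_measure) (use R in auto)
    also have "\<dots> \<le> (\<integral>\<^sup>+ x. u i (complex_of_real x) \<partial>lborel) / ennreal R"
      by (intro divide_right_mono_ennreal nn_integral_mono) (auto simp: indicator_def)
    also have "\<dots> \<le> ennreal (4 * R) / ennreal R"
      unfolding u_def Re_complex_of_real
      by (intro divide_right_mono_ennreal nn_integral_minus_ln_scaled R)
    also have "\<dots> = 4" using R by (simp add: divide_ennreal)
    finally show ?thesis .
  qed
  \<comment> \<open>Off this finite set, and on the real axis, every logarithm below has a positive
    argument.\<close>
  have "AE z in ?S. z \<notin> {z. poly q z = 0} \<union> (\<lambda>i. complex_of_real (Re (root i))) ` {..<?d}"
    by (intro AE_segment_measure R finite_UnI poly_roots_finite q0) auto
  moreover have "AE z in ?S. Im z = 0"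
    unfolding segment_measure_def by (subst AE_distr_iff) auto
  ultimately have pw: "AE z in ?S. log_neg q z + ennreal (real ?d * ln R) \<le> log_pos q z + (\<Sum>i<?d. u i z)"
  proof eventually_elim
    case (elim z)
    have ri: "Re z \<noteq> Re (root i)" if "i < ?d" for i
      using elim that by (auto simp: complex_eq_iff)
    have qz: "poly q z \<noteq> 0" using elim by auto
    let ?u = "\<lambda>i. max 0 (- ln (\<bar>Re z - Re (root i)\<bar> / R))"
    have "poly q z = lead_coeff q * (\<Prod>i<?d. z - root i)"
      by (subst root[symmetric]) (simp add: poly_prod)
    then have cq: "cmod (poly q z) = cmod (lead_coeff q) * (\<Prod>i<?d. cmod (z - root i))"
      by (simp add: norm_mult prod_norm)
    have zr: "z - root i \<noteq> 0" if "i < ?d" for i using ri[OF that] by auto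
    have "ln R - ?u i \<le> ln (cmod (z - root i))" if i: "i < ?d" for i
    proof -
      have "ln R - ?u i \<le> ln R + ln (\<bar>Re z - Re (root i)\<bar> / R)" by simp
      also have "\<dots> = ln \<bar>Re z - Re (root i)\<bar>"
        using ri[OF i] R by (subst ln_div) auto
      also have "\<dots> \<le> ln (cmod (z - root i))"
        using ri[OF i] abs_Re_le_cmod[of "z - root i"] by (intro ln_mono) auto
      finally show ?thesis .
    qed
    then have "(\<Sum>i<?d. ln R - ?u i) \<le> (\<Sum>i<?d. ln (cmod (z - root i)))"
      by (intro sum_mono) auto
    also have "\<dots> = ln (\<Prod>i<?d. cmod (z - root i))"
      using zr by (subst ln_prod) auto
    also have "\<dots> \<le> ln (cmod (lead_coeff q)) + ln (\<Prod>i<?d. cmod (z - root i))"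
      using q by simp
    also have "\<dots> = ln (cmod (poly q z))"
      unfolding cq using q0 zr by (intro ln_mult_pos[symmetric] prod_pos) auto
    finally have "real ?d * ln R - (\<Sum>i<?d. ?u i) \<le> ln (cmod (poly q z))"
      by (simp add: sum_subtractf)
    moreover have "ln (cmod (poly q z)) = ln (max 1 (cmod (poly q z))) - max 0 (- ln (cmod (poly q z)))"
      using qz by (auto simp: max_def)
    ultimately have le: "max 0 (- ln (cmod (poly q z))) + real ?d * ln R
        \<le> ln (max 1 (cmod (poly q z))) + (\<Sum>i<?d. ?u i)" by linarith
    have "log_neg q z + ennreal (real ?d * ln R)
        = ennreal (max 0 (- ln (cmod (poly q z))) + real ?d * ln R)"
      using qz by (subst ennreal_plus[OF _ dR])
        (auto simp: log_neg_def e2ennreal_minus_elog ennreal_max_0)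
    also have "\<dots> \<le> ennreal (ln (max 1 (cmod (poly q z))) + (\<Sum>i<?d. ?u i))"
      using le by (rule ennreal_leI)
    also have "\<dots> = log_pos q z + (\<Sum>i<?d. u i z)"
      by (subst ennreal_plus)
        (auto simp: log_pos_def e2ennreal_elog u_def sum_ennreal[symmetric] sum_nonneg ennreal_max_0)
    finally show ?case .
  qed
  have m [measurable]: "log_neg q \<in> borel_measurable ?S" "log_pos q \<in> borel_measurable ?S" "u i \<in> borel_measurable ?S" for i
    by (simp_all add: measurable_cong_sets[OF sets_segment_measure refl])
  have "(\<integral>\<^sup>+ z. log_neg q z \<partial>?S) + ennreal (real ?d * ln R) = (\<integral>\<^sup>+ z. log_neg q z + ennreal (real ?d * ln R) \<partial>?S)"
    by (simp add: nn_integral_add emeasure_space_1)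
  also have "\<dots> \<le> (\<integral>\<^sup>+ z. log_pos q z + (\<Sum>i<?d. u i z) \<partial>?S)"
    by (rule nn_integral_mono_AE[OF pw])
  also have "\<dots> = (\<integral>\<^sup>+ z. log_pos q z \<partial>?S) + (\<Sum>i<?d. \<integral>\<^sup>+ z. u i z \<partial>?S)"
    by (simp add: nn_integral_add nn_integral_sum)
  also have "\<dots> \<le> (\<integral>\<^sup>+ z. log_pos q z \<partial>?S) + (\<Sum>i<?d. 4)"
    by (intro add_left_mono sum_mono ui)
  also have "(\<Sum>i<?d. 4) = ennreal (4 * real ?d)"
    by (simp add: ennreal_mult' ennreal_of_nat_eq_real_of_nat mult.commute)
  finally have "(\<integral>\<^sup>+ z. log_neg q z \<partial>?S) + ennreal (real ?d * ln R) \<le> (\<integral>\<^sup>+ z. log_pos q z \<partial>?S) + ennreal (4 * real ?d)" .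
  moreover have "ennreal (real ?d * ln R) = ennreal (real ?d * (ln R - 4)) + ennreal (4 * real ?d)"
  proof -
    have "0 \<le> real ?d * (ln R - 4)" using R(1) by (intro mult_nonneg_nonneg) auto
    then have "ennreal (real ?d * (ln R - 4)) + ennreal (4 * real ?d)
        = ennreal (real ?d * (ln R - 4) + 4 * real ?d)"
      by (rule ennreal_plus[symmetric]) simp
    then show ?thesis by (simp add: algebra_simps)
  qed
  \<comment> \<open>The finite summand can be cancelled even if the integrals are infinite.\<close>
  ultimately have "ennreal (4 * real ?d) + ((\<integral>\<^sup>+ z. log_neg q z \<partial>?S) + ennreal (real ?d * (ln R - 4)))
    \<le> ennreal (4 * real ?d) + (\<integral>\<^sup>+ z. log_pos q z \<partial>?S)"
    by (simp add: ac_simps)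
  then show ?thesis
    by (subst (asm) ennreal_add_left_cancel_le) auto
qed

subsection \<open>Mixtures and feasibility\<close>

text \<open>A biased coin with weight t on N; as a bind it inherits measurability and integration
  from the monad.\<close>

definition mix_measure :: "real \<Rightarrow> 'a measure \<Rightarrow> 'a measure \<Rightarrow> 'a measure" where
  "mix_measure t M N = measure_pmf (bernoulli_pmf t) \<bind> (\<lambda>b. if b then N else M)"

locale prob_mixture = M: prob_space M + N: prob_space N
  for M N :: "'a::topological_space measure" and t :: real +
  assumes sets_M: "sets M = sets borel" and sets_N: "sets N = sets borel"
    and t: "0 \<le> t" "t \<le> 1"
begin

lemma kernel: "(\<lambda>b. if b then N else M) \<in> measure_pmf p \<rightarrow>\<^sub>M subprob_algebra borel"
  by (auto simp: measurable_cong_sets[OF sets_measure_pmf_count_space refl]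
      measurable_count_space_eq1 space_subprob_algebra sets_M sets_N
      M.subprob_space_axioms N.subprob_space_axioms)

lemma sets_mix [simp]: "sets (mix_measure t M N) = sets borel"
  unfolding mix_measure_def by (rule sets_bind[OF _ _]) (auto simp: sets_M sets_N)

lemma prob_space_mix: "prob_space (mix_measure t M N)"
  unfolding mix_measure_def
  by (rule prob_space.prob_space_bind[OF measure_pmf.prob_space_axioms _ kernel])
    (auto simp: M.prob_space_axioms N.prob_space_axioms)

lemma nn_integral_mix:
  assumes "f \<in> borel_measurable borel"
  shows "(\<integral>\<^sup>+ x. f x \<partial>mix_measure t M N) =
    ennreal (1 - t) * (\<integral>\<^sup>+ x. f x \<partial>M) + ennreal t * (\<integral>\<^sup>+ x. f x \<partial>N)"
  unfolding mix_measure_def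
  by (subst nn_integral_bind[OF assms kernel], subst nn_integral_bernoulli_pmf)
    (use t in \<open>auto simp: mult.commute add.commute\<close>)

lemma integral_mix:
  fixes f :: "'a \<Rightarrow> real"
  assumes f: "f \<in> borel_measurable borel" "integrable M f" "integrable N f"
  shows "integrable (mix_measure t M N) f"
    and "integral\<^sup>L (mix_measure t M N) f = (1 - t) * integral\<^sup>L M f + t * integral\<^sup>L N f"
proof -
  note [measurable] = f(1)
  have fin: "(\<integral>\<^sup>+ x. ennreal (f x) \<partial>M) \<noteq> \<infinity>" "(\<integral>\<^sup>+ x. ennreal (- f x) \<partial>M) \<noteq> \<infinity>"
    "(\<integral>\<^sup>+ x. ennreal (f x) \<partial>N) \<noteq> \<infinity>" "(\<integral>\<^sup>+ x. ennreal (- f x) \<partial>N) \<noteq> \<infinity>"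
    using f(2,3) by (auto simp: real_integrable_def)
  have eq: "(\<integral>\<^sup>+ x. ennreal (f x) \<partial>mix_measure t M N) =
      ennreal (1 - t) * (\<integral>\<^sup>+ x. ennreal (f x) \<partial>M) + ennreal t * (\<integral>\<^sup>+ x. ennreal (f x) \<partial>N)"
    "(\<integral>\<^sup>+ x. ennreal (- f x) \<partial>mix_measure t M N) =
      ennreal (1 - t) * (\<integral>\<^sup>+ x. ennreal (- f x) \<partial>M) + ennreal t * (\<integral>\<^sup>+ x. ennreal (- f x) \<partial>N)"
    by (rule nn_integral_mix; measurable)+
  show i: "integrable (mix_measure t M N) f"
    unfolding real_integrable_def eq using fin f(1)
    by (auto simp: measurable_cong_sets[OF sets_mix refl] ennreal_mult_eq_top_iff)
  have er: "enn2real (ennreal (1 - t) * a + ennreal t * b) = (1 - t) * enn2real a + t * enn2real b"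
    if "a \<noteq> \<infinity>" "b \<noteq> \<infinity>" for a b
    using that t by (subst enn2real_plus)
      (auto simp: enn2real_mult less_top[symmetric] ennreal_mult_eq_top_iff)
  show "integral\<^sup>L (mix_measure t M N) f = (1 - t) * integral\<^sup>L M f + t * integral\<^sup>L N f"
    unfolding real_lebesgue_integral_def[OF i] real_lebesgue_integral_def[OF f(2)]
      real_lebesgue_integral_def[OF f(3)] eq er[OF fin(1,3)] er[OF fin(2,4)]
    by (simp add: algebra_simps)
qed

end

lemma ext_integral_real:
  fixes f :: "'a \<Rightarrow> real"
  assumes "integrable M f"
  shows "ext_integral M (\<lambda>x. ereal (f x)) = ereal (integral\<^sup>L M f)"
proof -
  have fin: "(\<integral>\<^sup>+ x. ennreal (f x) \<partial>M) \<noteq> \<infinity>" "(\<integral>\<^sup>+ x. ennreal (- f x) \<partial>M) \<noteq> \<infinity>"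
    using assms by (auto simp: real_integrable_def)
  then obtain a b where ab: "(\<integral>\<^sup>+ x. ennreal (f x) \<partial>M) = ennreal a" "a \<ge> 0"
    "(\<integral>\<^sup>+ x. ennreal (- f x) \<partial>M) = ennreal b" "b \<ge> 0"
    by (metis ennreal_cases infinity_ennreal_def)
  then show ?thesis
    by (simp add: ext_integral_def real_lebesgue_integral_def[OF assms] enn2ereal_ennreal)
qed

lemma ext_integral_nonneg_iff:
  assumes "(\<integral>\<^sup>+ x. e2ennreal (f x) \<partial>M) \<noteq> \<infinity>"
  shows "ext_integral M f \<ge> 0 \<longleftrightarrow> (\<integral>\<^sup>+ x. e2ennreal (- f x) \<partial>M) \<le> (\<integral>\<^sup>+ x. e2ennreal (f x) \<partial>M)"
proof -
  obtain a where a: "(\<integral>\<^sup>+ x. e2ennreal (f x) \<partial>M) = ennreal a" "a \<ge> 0"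
    using assms by (metis ennreal_cases infinity_ennreal_def)
  show ?thesis
    by (cases "\<integral>\<^sup>+ x. e2ennreal (- f x) \<partial>M" rule: ennreal_cases)
      (use a in \<open>auto simp: ext_integral_def enn2ereal_ennreal top_unique\<close>)
qed

definition cpoly :: "int poly \<Rightarrow> complex poly" where
  "cpoly p = map_poly of_int p"

lemma degree_cpoly [simp]: "degree (cpoly p) = degree p"
  unfolding cpoly_def by (rule degree_map_poly) auto

text \<open>Integrality enters here: a nonzero integer has absolute value at least 1.\<close>

lemma lead_coeff_cpoly: "p \<noteq> 0 \<Longrightarrow> cmod (lead_coeff (cpoly p)) \<ge> 1"
proof -
  assume "p \<noteq> 0"
  then have "\<bar>lead_coeff p\<bar> \<ge> 1" by (simp add: int_one_le_iff_zero_less)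
  moreover have "cmod (lead_coeff (cpoly p)) = real_of_int \<bar>lead_coeff p\<bar>"
    by (simp add: degree_cpoly[unfolded cpoly_def] cpoly_def coeff_map_poly)
  ultimately show ?thesis by linarith
qed

lemma cpoly_nonzero: "p \<noteq> 0 \<Longrightarrow> cpoly p \<noteq> 0"
  using lead_coeff_cpoly[of p] by auto

lemma log_abs_poly_eq: "log_abs_poly p z = elog (cmod (poly (cpoly p) z))"
  by (simp add: log_abs_poly_def cpoly_def)

lemma P_log_iff:
  "\<mu> \<in> P_log \<longleftrightarrow> prob_space \<mu> \<and> sets \<mu> = sets borel \<and> integrable \<mu> log_plus"
proof -
  have "integrable \<mu> log_plus \<longleftrightarrow> (\<integral>\<^sup>+ z. ennreal (max 0 (ln (cmod z))) \<partial>\<mu>) < \<infinity>" if "sets \<mu> = sets borel"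
  proof -
    have "log_plus \<in> borel_measurable \<mu>"
      by (simp add: measurable_cong_sets[OF that refl])
    moreover have "ennreal (norm (log_plus z)) = ennreal (max 0 (ln (cmod z)))" for z
      by (simp add: log_plus_def)
    ultimately show ?thesis by (simp add: integrable_iff_bounded)
  qed
  then show ?thesis unfolding P_log_def by auto
qed

lemma primal_feasible_iff:
  "\<mu> \<in> primal_feasible Q \<longleftrightarrow> \<mu> \<in> P_log \<and>
    (\<forall>n. (\<integral>\<^sup>+ z. log_neg (cpoly (Q n)) z \<partial>\<mu>) \<le> (\<integral>\<^sup>+ z. log_pos (cpoly (Q n)) z \<partial>\<mu>))"
proof -
  have "ext_integral \<mu> (log_abs_poly (Q n)) \<ge> 0 \<longleftrightarrow>
      (\<integral>\<^sup>+ z. log_neg (cpoly (Q n)) z \<partial>\<mu>) \<le> (\<integral>\<^sup>+ z. log_pos (cpoly (Q n)) z \<partial>\<mu>)"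
    if "\<mu> \<in> P_log" for n
    using nn_integral_log_pos_finite[of \<mu> "cpoly (Q n)"] that
    by (subst ext_integral_nonneg_iff)
      (auto simp: log_neg_def[abs_def] log_pos_def[abs_def] log_abs_poly_eq P_log_iff)
  then show ?thesis by (auto simp: primal_feasible_def)
qed

text \<open>On the segment \<open>log_plus\<close> is at most ln R, so its cost in g has the same
  leading order as its gain ln R - 4 per degree.\<close>

lemma integrable_segment_measure:
  fixes h :: "complex \<Rightarrow> real"
  assumes R: "R \<ge> 1" and h: "h \<in> borel_measurable borel"
    and le: "\<And>z. \<bar>h z\<bar> \<le> a * log_plus z + B" and a: "a \<ge> 0"
  shows "integrable (segment_measure R) h" "integral\<^sup>L (segment_measure R) h \<le> a * ln R + B"
proof -
  interpret prob_space "segment_measure R" by (rule prob_space_segment_measure) (use R in simp)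
  have "AE x in uniform_measure lborel {0..R}. complex_of_real x \<in> cball 0 R"
    by (rule AE_uniform_measureI) auto
  then have AE: "AE z in segment_measure R. z \<in> cball 0 R"
    unfolding segment_measure_def by (subst AE_distr_iff) auto
  have "\<bar>h z\<bar> \<le> a * ln R + B" if "z \<in> cball 0 R" for z
  proof -
    have "log_plus z \<le> ln R"
      unfolding log_plus_eq using that R by (intro ln_mono) auto
    then show ?thesis using le[of z] a mult_left_mono[of "log_plus z" "ln R" a] by linarith
  qed
  then have AEh: "AE z in segment_measure R. \<bar>h z\<bar> \<le> a * ln R + B"
    using AE by (auto elim: eventually_mono)
  show i: "integrable (segment_measure R) h"
    by (rule integrable_const_bound[of _ "a * ln R + B"])
      (use AEh h in \<open>auto simp: measurable_cong_sets[OF sets_segment_measure refl]\<close>)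
  show "integral\<^sup>L (segment_measure R) h \<le> a * ln R + B"
    by (rule integral_le_const[OF i]) (use AEh in \<open>auto elim: eventually_mono\<close>)
qed

lemma segment_measure_feasible:
  assumes R: "ln R \<ge> 4" "R > 0" and Q: "\<And>n. Q n \<noteq> 0"
  shows "segment_measure R \<in> primal_feasible Q"
proof -
  have R1: "R \<ge> 1" using R by (metis ln_ge_zero_iff order_trans zero_le_numeral)
  have "segment_measure R \<in> P_log"
    unfolding P_log_iff using R R1
    by (auto intro!: prob_space_segment_measure integrable_segment_measure(1)[of R _ 1 0] simp: log_plus_nonneg)
  moreover have "(\<integral>\<^sup>+ z. log_neg (cpoly (Q n)) z \<partial>segment_measure R)
      \<le> (\<integral>\<^sup>+ z. log_pos (cpoly (Q n)) z \<partial>segment_measure R)" for n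
    using segment_measure_log_poly[OF R lead_coeff_cpoly[OF Q[of n]]]
    by (auto intro: order_trans[rotated] simp: le_iff_add)
  ultimately show ?thesis by (simp add: primal_feasible_iff)
qed

text \<open>The weight t solves (1 - t) c = t (ln R - 4): the weighted deficit of \<mu> equals the
  weighted surplus of the segment. Both are proportional to the degree, so a single t serves every
  n.\<close>

lemma mix_segment_feasible:
  fixes Q :: "nat \<Rightarrow> int poly"
  assumes \<mu>: "\<mu> \<in> P_log" and c: "c \<ge> 0" and Q: "\<And>n. Q n \<noteq> 0"
    and con: "\<And>n. (\<integral>\<^sup>+ z. log_neg (cpoly (Q n)) z \<partial>\<mu>) \<le>
      (\<integral>\<^sup>+ z. log_pos (cpoly (Q n)) z \<partial>\<mu>) + ennreal (real (degree (Q n)) * c)"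
    and R: "ln R > 4" "R > 0" and t: "t = c / (c + (ln R - 4))"
  shows "mix_measure t \<mu> (segment_measure R) \<in> primal_feasible Q"
    and "prob_mixture \<mu> (segment_measure R) t"
proof -
  have t01: "0 \<le> t" "t \<le> 1" using c R by (auto simp: t divide_simps)
  have bal: "(1 - t) * c = t * (ln R - 4)"
    using c R by (simp add: t field_simps)
  have prob: "prob_space \<mu>" and sets: "sets \<mu> = sets borel" and lp: "integrable \<mu> log_plus"
    using \<mu> by (auto simp: P_log_iff)
  show mix: "prob_mixture \<mu> (segment_measure R) t"
    unfolding prob_mixture_def prob_mixture_axioms_def
    using prob sets t01 R by (auto intro!: prob_space_segment_measure)
  interpret prob_mixture \<mu> "segment_measure R" t by (rule mix)
  have R1: "R \<ge> 1" using R by (metis ln_ge_zero_iff less_imp_le order_trans zero_le_numeral)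
  let ?K = "mix_measure t \<mu> (segment_measure R)"
  have "integrable ?K log_plus"
    by (rule integral_mix) (use lp R1 in \<open>auto intro!: integrable_segment_measure(1)[of R _ 1 0] simp: log_plus_nonneg\<close>)
  then have K: "?K \<in> P_log" by (simp add: P_log_iff prob_space_mix)
  moreover have "(\<integral>\<^sup>+ z. log_neg (cpoly (Q n)) z \<partial>?K) \<le> (\<integral>\<^sup>+ z. log_pos (cpoly (Q n)) z \<partial>?K)" for n
  proof -
    let ?q = "cpoly (Q n)" and ?d = "real (degree (Q n))"
    let ?S = "segment_measure R"
    let ?nm = "\<integral>\<^sup>+ z. log_neg ?q z \<partial>\<mu>" and ?pm = "\<integral>\<^sup>+ z. log_pos ?q z \<partial>\<mu>"
    let ?ns = "\<integral>\<^sup>+ z. log_neg ?q z \<partial>?S" and ?ps = "\<integral>\<^sup>+ z. log_pos ?q z \<partial>?S"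
    have seg: "?ns + ennreal (?d * (ln R - 4)) \<le> ?ps"
      using segment_measure_log_poly[OF _ R(2) lead_coeff_cpoly[OF Q[of n]]] R(1) by simp
    have "(\<integral>\<^sup>+ z. log_neg ?q z \<partial>?K) = ennreal (1 - t) * ?nm + ennreal t * ?ns"
      by (rule nn_integral_mix) measurable
    also have "\<dots> \<le> ennreal (1 - t) * (?pm + ennreal (?d * c)) + ennreal t * ?ns"
      by (intro add_right_mono mult_left_mono con) simp
    also have "\<dots> = ennreal (1 - t) * ?pm + (ennreal (1 - t) * ennreal (?d * c) + ennreal t * ?ns)"
      by (simp add: distrib_left add.assoc)
    also have "ennreal (1 - t) * ennreal (?d * c) = ennreal (?d * ((1 - t) * c))"
      using t01 c by (subst ennreal_mult[symmetric]) (auto simp: mult_ac)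
    also have "\<dots> = ennreal t * ennreal (?d * (ln R - 4))"
      unfolding bal using t01 R by (subst ennreal_mult[symmetric]) (auto simp: mult_ac)
    also have "ennreal (1 - t) * ?pm + (ennreal t * ennreal (?d * (ln R - 4)) + ennreal t * ?ns)
        = ennreal (1 - t) * ?pm + ennreal t * (?ns + ennreal (?d * (ln R - 4)))"
      by (simp add: distrib_left add.commute)
    also have "\<dots> \<le> ennreal (1 - t) * ?pm + ennreal t * ?ps"
      by (intro add_left_mono mult_left_mono seg) simp
    also have "\<dots> = (\<integral>\<^sup>+ z. log_pos ?q z \<partial>?K)"
      by (rule nn_integral_mix[symmetric]) measurable
    finally show ?thesis .
  qed
  ultimately show "?K \<in> primal_feasible Q" by (simp add: primal_feasible_iff)
qed

text \<open>The escaped mass \<open>c\<close> is realised by a long segment of small total mass.\<close>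

lemma primal_value_le_of_escape:
  fixes Q :: "nat \<Rightarrow> int poly" and g :: "complex \<Rightarrow> real"
  assumes \<mu>: "\<mu> \<in> P_log" and c: "c \<ge> 0" and Q: "\<And>n. Q n \<noteq> 0"
    and con: "\<And>n. (\<integral>\<^sup>+ z. log_neg (cpoly (Q n)) z \<partial>\<mu>) \<le>
      (\<integral>\<^sup>+ z. log_pos (cpoly (Q n)) z \<partial>\<mu>) + ennreal (real (degree (Q n)) * c)"
    and cont: "continuous_on UNIV g"
    and growth: "(\<lambda>z. g z - ln (cmod z)) \<in> o[at_infinity](\<lambda>z. ln (cmod z))"
    and v: "integral\<^sup>L \<mu> g + c \<le> v"
  shows "primal_value Q g \<le> ereal v"
proof (rule ereal_le_epsilon2)
  fix \<delta> :: real assume \<delta>: "\<delta> > 0"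
  define \<epsilon> where "\<epsilon> = min 1 (\<delta> / (2 * (c + 1)))"
  have \<epsilon>: "\<epsilon> > 0" "\<epsilon> \<le> 1" using \<delta> c by (auto simp: \<epsilon>_def)
  have "\<epsilon> * c \<le> \<delta> / (2 * (c + 1)) * c"
    using c by (intro mult_right_mono) (auto simp: \<epsilon>_def)
  also have "\<dots> \<le> \<delta> / 2" using \<delta> c by (simp add: divide_simps mult_left_mono)
  finally have \<epsilon>c: "\<epsilon> * c \<le> \<delta> / 2" .
  obtain B where B: "\<And>z. \<bar>g z - log_plus z\<bar> \<le> \<epsilon> * log_plus z + B"
    using growth_log_plus[OF cont growth \<epsilon>(1)] by blast
  \<comment> \<open>Bounds 4 (1 + \<epsilon>) + B - v, the cost per unit of t left after the leading
    terms cancel; 8 comes from \<epsilon> \<le> 1.\<close>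
  define W where "W = \<bar>v\<bar> + 8 + \<bar>B\<bar>"
  have W: "W > 0" by (simp add: W_def)
  \<comment> \<open>The surplus ln R - 4, chosen so large that t W, which is at most c W / X, stays
    below \<delta> / 2.\<close>
  define X where "X = 2 * (c + 1) * W / \<delta>"
  have X: "X > 0" using W c \<delta> by (simp add: X_def)
  define R where "R = exp (4 + X)"
  have R: "ln R = 4 + X" "R > 0" "R \<ge> 1" using X by (auto simp: R_def)
  define t where "t = c / (c + X)"
  have t_bal: "(1 - t) * c = t * X"
    using c X by (auto simp: t_def field_simps)
  have "t * W \<le> c / X * W"
    using c X W by (intro mult_right_mono) (auto simp: t_def intro!: divide_left_mono)
  also have "\<dots> = \<delta> / 2 * (c / (c + 1))" using W c \<delta> by (simp add: X_def divide_simps)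
  also have "\<dots> \<le> \<delta> / 2 * 1" using c \<delta> by (intro mult_left_mono) (auto simp: divide_simps)
  finally have tW: "t * W \<le> \<delta> / 2" by simp
  have R4: "ln R > 4" using R X by simp
  have t': "t = c / (c + (ln R - 4))" by (simp add: t_def R)
  let ?S = "segment_measure R"
  let ?K = "mix_measure t \<mu> ?S"
  have K: "?K \<in> primal_feasible Q"
    by (rule mix_segment_feasible(1)[OF \<mu> c Q con R4 R(2) t'])
  interpret prob_mixture \<mu> ?S t
    by (rule mix_segment_feasible(2)[OF \<mu> c Q con R4 R(2) t'])
  have gm: "g \<in> borel_measurable borel" using cont by (rule borel_measurable_continuous_onI)
  have gi: "integrable \<mu> g"
    by (rule integrable_log_growth[where \<kappa> = 1 and \<epsilon> = \<epsilon> and B = B])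
      (use \<mu> gm B in \<open>auto simp: P_log_iff\<close>)
  have gb: "\<bar>g z\<bar> \<le> (1 + \<epsilon>) * log_plus z + B" for z
    using B[of z] log_plus_nonneg[of z] by (simp add: algebra_simps)
  have gs: "integrable ?S g" "integral\<^sup>L ?S g \<le> (1 + \<epsilon>) * ln R + B"
    using integrable_segment_measure[OF R(3) gm gb] \<epsilon> by auto
  have "integral\<^sup>L ?K g = (1 - t) * integral\<^sup>L \<mu> g + t * integral\<^sup>L ?S g"
    by (rule integral_mix(2)[OF gm gi gs(1)])
  also have "\<dots> \<le> (1 - t) * (v - c) + t * ((1 + \<epsilon>) * (4 + X) + B)"
    using t v gs(2) by (intro add_mono mult_left_mono) (auto simp: R)
  \<comment> \<open>Rearranged so that the cost of the segment meets the saved escape cost in the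
    last bracket, which vanishes by \<open>t_bal\<close>.\<close>
  also have "\<dots> = v + \<epsilon> * ((1 - t) * c) + t * (4 * (1 + \<epsilon>) + B - v) - ((1 + \<epsilon>) * ((1 - t) * c - t * X))"
    by (simp add: algebra_simps)
  also have "\<dots> = v + \<epsilon> * ((1 - t) * c) + t * (4 * (1 + \<epsilon>) + B - v)"
    unfolding t_bal by simp
  also have "\<dots> \<le> v + \<epsilon> * (1 * c) + t * W"
    using t c \<epsilon> by (intro add_mono mult_left_mono mult_right_mono order_refl) (auto simp: W_def)
  also have "\<dots> \<le> v + \<delta>" using \<epsilon>c tW by simp
  finally have le: "integral\<^sup>L ?K g \<le> v + \<delta>" .
  have "primal_value Q g \<le> ext_integral ?K (\<lambda>z. ereal (g z))"
    unfolding primal_value_def by (rule INF_lower[OF K])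
  also have "\<dots> = ereal (integral\<^sup>L ?K g)"
    by (rule ext_integral_real[OF integral_mix(1)[OF gm gi gs(1)]])
  also have "\<dots> \<le> ereal v + ereal \<delta>" using le by simp
  finally show "primal_value Q g \<le> ereal v + ereal \<delta>" .
qed

text \<open>Feasibility makes the integral of \<open>log_neg\<close> finite, so \<mu> does not
  charge the roots and the extended expression is real almost everywhere; integrating the pointwise
  bound leaves the nonnegative constraint terms to be dropped.\<close>

lemma weak_duality:
  fixes Q :: "nat \<Rightarrow> int poly" and g :: "complex \<Rightarrow> real"
  assumes \<mu>: "\<mu> \<in> primal_feasible Q" and a: "a \<in> dual_feasible" and g: "integrable \<mu> g"
  shows "(INF z. ereal (g z) - (\<Sum>n | a n \<noteq> 0. ereal (a n) * log_abs_poly (Q n) z))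
    \<le> ereal (integral\<^sup>L \<mu> g)" (is "?I \<le> _")
proof -
  have prob: "prob_space \<mu>" and sets: "sets \<mu> = sets borel" and lp: "integrable \<mu> log_plus"
    and con: "\<And>n. (\<integral>\<^sup>+ z. log_neg (cpoly (Q n)) z \<partial>\<mu>) \<le> (\<integral>\<^sup>+ z. log_pos (cpoly (Q n)) z \<partial>\<mu>)"
    using \<mu> by (auto simp: primal_feasible_iff P_log_iff)
  interpret prob_space \<mu> by (rule prob)
  let ?f = "\<lambda>n z. ln (cmod (poly (cpoly (Q n)) z))"
  have fm: "?f n \<in> borel_measurable \<mu>" "log_neg (cpoly (Q n)) \<in> borel_measurable \<mu>" for n
    by (simp_all add: measurable_cong_sets[OF sets refl])
  have pos_fin: "(\<integral>\<^sup>+ z. log_pos (cpoly (Q n)) z \<partial>\<mu>) < \<infinity>" for n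
    by (rule nn_integral_log_pos_finite[OF prob sets lp])
  have neg_fin: "(\<integral>\<^sup>+ z. log_neg (cpoly (Q n)) z \<partial>\<mu>) < \<infinity>" for n
    using con pos_fin by (rule order_le_less_trans)
  have nz: "AE z in \<mu>. poly (cpoly (Q n)) z \<noteq> 0" for n
  proof -
    have "AE z in \<mu>. log_neg (cpoly (Q n)) z \<noteq> \<infinity>"
      by (rule nn_integral_PInf_AE[OF fm(2)]) (use neg_fin[of n] in auto)
    then show ?thesis
      by eventually_elim (auto simp: log_neg_def e2ennreal_minus_elog)
  qed
  have pos: "(\<integral>\<^sup>+ z. ennreal (?f n z) \<partial>\<mu>) = (\<integral>\<^sup>+ z. log_pos (cpoly (Q n)) z \<partial>\<mu>)" for n
    by (rule nn_integral_cong_AE, use nz[of n] in eventually_elim)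
      (auto simp: log_pos_def e2ennreal_elog max_def ennreal_neg)
  have neg: "(\<integral>\<^sup>+ z. ennreal (- ?f n z) \<partial>\<mu>) = (\<integral>\<^sup>+ z. log_neg (cpoly (Q n)) z \<partial>\<mu>)" for n
    by (rule nn_integral_cong_AE, use nz[of n] in eventually_elim)
      (auto simp: log_neg_def e2ennreal_minus_elog)
  have fi: "integrable \<mu> (?f n)" for n
    unfolding real_integrable_def pos neg using fm pos_fin[of n] neg_fin[of n] by auto
  have f0: "0 \<le> integral\<^sup>L \<mu> (?f n)" for n
    unfolding real_lebesgue_integral_def[OF fi] pos neg
    using con[of n] pos_fin[of n] by (simp add: enn2real_mono)
  define S where "S = {n. a n \<noteq> 0}"
  have S: "finite S" and a0: "\<And>n. a n \<ge> 0" using a by (auto simp: dual_feasible_def S_def)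
  let ?G = "\<lambda>z. g z - (\<Sum>n\<in>S. a n * ?f n z)"
  have "AE z in \<mu>. \<forall>n\<in>S. poly (cpoly (Q n)) z \<noteq> 0"
    by (rule AE_finite_allI[OF S]) (rule nz)
  then have AE: "AE z in \<mu>. ?I \<le> ereal (?G z)"
  proof eventually_elim
    case (elim z)
    have "?I \<le> ereal (g z) - (\<Sum>n | a n \<noteq> 0. ereal (a n) * log_abs_poly (Q n) z)"
      by (rule INF_lower) simp
    also have "(\<Sum>n | a n \<noteq> 0. ereal (a n) * log_abs_poly (Q n) z) = (\<Sum>n\<in>S. ereal (a n * ?f n z))"
      unfolding S_def[symmetric] using elim by (intro sum.cong) (auto simp: log_abs_poly_eq elog_def)
    finally show ?case by simp
  qed
  have Gi: "integrable \<mu> ?G" using g fi by auto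
  show ?thesis
  proof (cases ?I)
    case (real i)
    have "AE z in \<mu>. i \<le> ?G z" using AE unfolding real by simp
    then have "i \<le> integral\<^sup>L \<mu> ?G" by (rule integral_ge_const[OF Gi])
    also have "\<dots> = integral\<^sup>L \<mu> g - (\<Sum>n\<in>S. a n * integral\<^sup>L \<mu> (?f n))"
      using g fi by simp
    also have "\<dots> \<le> integral\<^sup>L \<mu> g"
      using f0 a0 by (simp add: sum_nonneg)
    finally show ?thesis using real by simp
  next
    case PInf
    then have "AE z in \<mu>. False" using AE by simp
    then show ?thesis by simp
  qed simp
qed

subsection \<open>Strong duality\<close>

lemma sum_ereal_MInf:
  fixes f :: "'a \<Rightarrow> ereal"
  assumes "finite S" "n \<in> S" "f n = - \<infinity>" "\<And>m. m \<in> S \<Longrightarrow> f m \<noteq> \<infinity>"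
  shows "sum f S = - \<infinity>"
proof -
  have "sum f (S - {n}) \<noteq> \<infinity>" using assms by (subst sum_Pinfty) auto
  then show ?thesis using assms by (simp add: sum.remove)
qed

lemma ge_on_cofinite_imp_ge:
  fixes G :: "complex \<Rightarrow> real"
  assumes "isCont G z" "finite A" "\<And>w. w \<notin> A \<Longrightarrow> v \<le> G w"
  shows "v \<le> G z"
proof (rule tendsto_lowerbound)
  show "(G \<longlongrightarrow> G z) (at z)" using assms(1) by (simp add: isCont_def)
  have "\<not> z islimpt A" using assms(2) by (rule islimpt_finite)
  then have "\<forall>\<^sub>F w in at z. w \<notin> A" by (simp add: islimpt_iff_eventually)
  then show "\<forall>\<^sub>F w in at z. v \<le> G w" by eventually_elim (rule assms(3))
qed simp

text \<open>At a zero of some Q i with positive multiplier the objective is infinite. At the other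
  excluded points only zero multipliers meet a vanishing polynomial, the objective is continuous
  there, and the bound extends from the cofinite set.\<close>

lemma dual_value_ge:
  fixes Q :: "nat \<Rightarrow> int poly" and g :: "complex \<Rightarrow> real"
  assumes cont: "continuous_on UNIV g" and Q: "\<And>n. Q n \<noteq> 0" and a: "\<And>i. a i \<ge> 0"
    and v: "\<And>z. (\<And>i. i < N \<Longrightarrow> poly (cpoly (Q i)) z \<noteq> 0) \<Longrightarrow>
      v \<le> g z - (\<Sum>i<N. a i * ln (cmod (poly (cpoly (Q i)) z)))"
  shows "ereal v \<le> dual_value Q g"
proof -
  define b where "b n = (if n < N then a n else 0)" for n
  define S where "S = {n. b n \<noteq> 0}"
  have SN: "S \<subseteq> {..<N}" by (auto simp: S_def b_def)
  then have S: "finite S" by (rule finite_subset) simp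
  have b: "b \<in> dual_feasible"
    using a S by (auto simp: dual_feasible_def S_def b_def)
  let ?f = "\<lambda>n z. ln (cmod (poly (cpoly (Q n)) z))"
  let ?G = "\<lambda>z. g z - (\<Sum>n\<in>S. b n * ?f n z)"
  have Geq: "?G z = g z - (\<Sum>i<N. a i * ?f i z)" for z
  proof -
    have "(\<Sum>i<N. a i * ?f i z) = (\<Sum>i<N. b i * ?f i z)" by (simp add: b_def)
    also have "\<dots> = (\<Sum>i\<in>S. b i * ?f i z)"
      by (rule sum.mono_neutral_right) (use SN in \<open>auto simp: S_def\<close>)
    finally show ?thesis by simp
  qed
  have A: "finite (\<Union>i<N. {z. poly (cpoly (Q i)) z = 0})"
  proof (intro finite_UN_I poly_roots_finite)
    show "cpoly (Q i) \<noteq> 0" for i by (rule cpoly_nonzero[OF Q])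
  qed simp
  have "ereal v \<le> ereal (g z) - (\<Sum>n | b n \<noteq> 0. ereal (b n) * log_abs_poly (Q n) z)" for z
  proof (cases "\<exists>n\<in>S. poly (cpoly (Q n)) z = 0")
    case True
    then obtain n where n: "n \<in> S" "poly (cpoly (Q n)) z = 0" by blast
    have bp: "b m > 0" if "m \<in> S" for m using that a[of m] by (auto simp: S_def b_def split: if_splits)
    have "(\<Sum>n\<in>S. ereal (b n) * log_abs_poly (Q n) z) = - \<infinity>"
    proof (rule sum_ereal_MInf[OF S n(1)])
      show "ereal (b n) * log_abs_poly (Q n) z = - \<infinity>"
        using n(2) bp[OF n(1)] by (simp add: log_abs_poly_eq elog_def)
      show "ereal (b m) * log_abs_poly (Q m) z \<noteq> \<infinity>" if "m \<in> S" for m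
        using bp[OF that] by (simp add: log_abs_poly_eq elog_def)
    qed
    then show ?thesis by (simp add: S_def)
  next
    case False
    have "(\<Sum>n\<in>S. ereal (b n) * log_abs_poly (Q n) z) = (\<Sum>n\<in>S. ereal (b n * ?f n z))"
      using False by (intro sum.cong) (auto simp: log_abs_poly_eq elog_def)
    moreover have "v \<le> ?G z"
    proof (rule ge_on_cofinite_imp_ge[OF _ A])
      show "isCont ?G z"
        using False cont by (intro continuous_intros) (auto simp: continuous_on_eq_continuous_at)
      show "v \<le> ?G w" if "w \<notin> (\<Union>i<N. {z. poly (cpoly (Q i)) z = 0})" for w
        unfolding Geq using that by (intro v) auto
    qed
    ultimately show ?thesis by (simp add: S_def)
  qed
  then have "ereal v \<le> (INF z. ereal (g z) - (\<Sum>n | b n \<noteq> 0. ereal (b n) * log_abs_poly (Q n) z))"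
    by (rule INF_greatest)
  also have "\<dots> \<le> dual_value Q g"
    unfolding dual_value_def by (rule SUP_upper[OF b])
  finally show ?thesis .
qed

text \<open>Otherwise \<open>lagrange_multipliers\<close> would yield an integrated inequality over
  all of X, and testing it on point masses would force the dual value up to v.\<close>

lemma exists_pmf_of_dual_less:
  fixes Q :: "nat \<Rightarrow> int poly" and g :: "complex \<Rightarrow> real"
  assumes cont: "continuous_on UNIV g" and Q: "\<And>n. degree (Q n) > 0"
    and v: "dual_value Q g < ereal v"
  shows "\<exists>p. finite (set_pmf p) \<and> (\<forall>i<N. (\<forall>z\<in>set_pmf p. poly (cpoly (Q i)) z \<noteq> 0) \<and>
      measure_pmf.expectation p (\<lambda>z. ln (cmod (poly (cpoly (Q i)) z))) \<ge> 0) \<and>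
    measure_pmf.expectation p g < v"
proof (rule ccontr)
  assume neg: "\<not> ?thesis"
  let ?f = "\<lambda>i z. ln (cmod (poly (cpoly (Q i)) z))"
  define Z where "Z = {z. \<forall>i<N. poly (cpoly (Q i)) z \<noteq> 0}"
  define X where "X = {p. finite (set_pmf p) \<and> set_pmf p \<subseteq> Z}"
  have Q0: "Q n \<noteq> 0" for n using Q[of n] by auto
  have "mix_pmf t p q \<in> X" if "p \<in> X" "q \<in> X" for t p q
  proof -
    have "finite (set_pmf p \<union> set_pmf q)" "set_pmf p \<union> set_pmf q \<subseteq> Z"
      using that by (simp_all add: X_def)
    then show ?thesis
      unfolding X_def using set_mix_pmf[of t p q] finite_subset by blast
  qed
  then have X: "mix_closed X" by (simp add: mix_closed_def X_def)
  \<comment> \<open>The Slater point: nonconstant polynomials exceed 1 in modulus far out.\<close>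
  have "\<exists>z. \<forall>i<N. cmod (poly (cpoly (Q i)) z) > 1"
  proof -
    have "\<forall>\<^sub>F z in at_infinity. cmod (poly (cpoly (Q i)) z) > 1" for i
    proof -
      obtain c q where cq: "cpoly (Q i) = pCons c q" by (cases "cpoly (Q i)")
      have "q \<noteq> 0" using Q[of i] degree_cpoly[of "Q i"] cq by auto
      then obtain r where "\<And>z. r \<le> cmod z \<Longrightarrow> 2 \<le> cmod (poly (cpoly (Q i)) z)"
        unfolding cq using poly_infinity[of q 2 c] by blast
      then show ?thesis by (force simp: eventually_at_infinity)
    qed
    then have "\<forall>\<^sub>F z in at_infinity. \<forall>i\<in>{..<N}. cmod (poly (cpoly (Q i)) z) > 1"
      by (intro eventually_ball_finite) auto
    then obtain b where "\<And>z. b \<le> cmod z \<Longrightarrow> \<forall>i\<in>{..<N}. cmod (poly (cpoly (Q i)) z) > 1"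
      unfolding eventually_at_infinity by blast
    then have "\<forall>i\<in>{..<N}. cmod (poly (cpoly (Q i)) (of_real \<bar>b\<bar>)) > 1" by simp
    then show ?thesis by auto
  qed
  then obtain z0 where z0: "\<And>i. i < N \<Longrightarrow> cmod (poly (cpoly (Q i)) z0) > 1" by blast
  have "\<exists>a. (\<forall>i. a i \<ge> 0) \<and>
    (\<forall>p\<in>X. measure_pmf.expectation p (\<lambda>z. g z - (\<Sum>i<N. a i * ?f i z)) \<ge> v)"
  proof (rule lagrange_multipliers[OF X])
    show "return_pmf z0 \<in> X"
      using z0 by (force simp: X_def Z_def)
    show "measure_pmf.expectation (return_pmf z0) (?f i) > 0" if "i < N" for i
      using ln_gt_zero[OF z0[OF that]] by simp
    show "measure_pmf.expectation p g \<ge> v"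
      if "p \<in> X" "\<And>i. i < N \<Longrightarrow> measure_pmf.expectation p (?f i) \<ge> 0" for p
    proof (rule ccontr)
      assume "\<not> ?thesis"
      then have "measure_pmf.expectation p g < v" by simp
      moreover have "finite (set_pmf p)" "\<forall>i<N. \<forall>z\<in>set_pmf p. poly (cpoly (Q i)) z \<noteq> 0"
        using that(1) by (auto simp: X_def Z_def)
      ultimately show False using neg that(2) by blast
    qed
  qed
  then obtain a where a: "\<And>i. a i \<ge> 0"
    "\<And>p. p \<in> X \<Longrightarrow> measure_pmf.expectation p (\<lambda>z. g z - (\<Sum>i<N. a i * ?f i z)) \<ge> v" by blast
  have "ereal v \<le> dual_value Q g"
  proof (rule dual_value_ge[where N = N and a = a, OF cont Q0 a(1)])
    show "v \<le> g z - (\<Sum>i<N. a i * ?f i z)" if "\<And>i. i < N \<Longrightarrow> poly (cpoly (Q i)) z \<noteq> 0" for z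
      using a(2)[of "return_pmf z"] that by (auto simp: X_def Z_def)
  qed
  with v show False by simp
qed

lemma primal_value_le:
  fixes Q :: "nat \<Rightarrow> int poly" and g :: "complex \<Rightarrow> real"
  assumes cont: "continuous_on UNIV g"
    and growth: "(\<lambda>z. g z - ln (cmod z)) \<in> o[at_infinity](\<lambda>z. ln (cmod z))"
    and Q: "\<And>n. degree (Q n) > 0" and v: "dual_value Q g < ereal v"
  shows "primal_value Q g \<le> ereal v"
proof -
  let ?E = "measure_pmf.expectation" and ?f = "\<lambda>i z. ln (cmod (poly (cpoly (Q i)) z))"
  have Q0: "Q n \<noteq> 0" for n using Q[of n] by auto
  obtain p where p: "\<And>N. finite (set_pmf (p N))" "\<And>N. ?E (p N) g < v"
    "\<And>N i. i < N \<Longrightarrow> (\<forall>z\<in>set_pmf (p N). poly (cpoly (Q i)) z \<noteq> 0) \<and> ?E (p N) (?f i) \<ge> 0"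
    using exists_pmf_of_dual_less[OF cont Q v] by metis
  \<comment> \<open>With \<epsilon> = 1/2, \<open>log_plus\<close> is at most 2 g + 2 B, so the
    bound on E g controls the logarithmic moments uniformly.\<close>
  obtain B where B: "\<And>z. \<bar>g z - log_plus z\<bar> \<le> 1 / 2 * log_plus z + B"
    using growth_log_plus[OF cont growth, of "1/2"] by auto
  define C where "C = 2 * (v + B)"
  have bound: "?E (p N) log_plus \<le> C" for N
  proof -
    have int: "integrable (measure_pmf (p N)) h" for h :: "complex \<Rightarrow> real"
      by (rule integrable_measure_pmf_finite[OF p(1)])
    have "log_plus z \<le> 2 * g z + 2 * B" for z
      using B[of z] by linarith
    then have "?E (p N) log_plus \<le> ?E (p N) (\<lambda>z. 2 * g z + 2 * B)"
      by (intro integral_mono int)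
    also have "\<dots> = 2 * ?E (p N) g + 2 * B" using int by simp
    finally show ?thesis using p(2)[of N] by (simp add: C_def)
  qed
  have "\<forall>N. ?E (p N) log_plus \<in> {0..C}"
    using bound by (simp add: log_plus_nonneg)
  then obtain L r1 where r1: "strict_mono (r1 :: nat \<Rightarrow> nat)"
    and L: "((\<lambda>N. ?E (p N) log_plus) \<circ> r1) \<longlonglongrightarrow> L"
    using compact_Icc[of 0 C, unfolded compact_def, THEN spec, of "\<lambda>N. ?E (p N) log_plus"]
    by blast
  obtain r2 \<mu> where r2: "strict_mono (r2 :: nat \<Rightarrow> nat)" and \<mu>: "prob_space \<mu>" "sets \<mu> = sets borel"
    and weak: "\<And>(h :: complex \<Rightarrow> real) B. continuous_on UNIV h \<Longrightarrow> (\<And>z. \<bar>h z\<bar> \<le> B) \<Longrightarrow>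
       (\<lambda>n. ?E (p (r1 (r2 n))) h) \<longlonglongrightarrow> integral\<^sup>L \<mu> h"
    using pmf_weak_limit[of "\<lambda>n. p (r1 n)" C] p(1) bound by blast
  have lim: "(\<lambda>n. ?E (p (r1 (r2 n))) log_plus) \<longlonglongrightarrow> L"
    using LIMSEQ_subseq_LIMSEQ[OF L r2] by (simp add: o_def)
  interpret log_escape "\<lambda>n. p (r1 (r2 n))" \<mu> L
    by (rule log_escape.intro) (rule p(1) \<mu> weak lim | assumption)+
  define c where "c = L - integral\<^sup>L \<mu> log_plus"
  have c: "c \<ge> 0" and lp: "integrable \<mu> log_plus" using log_plus_limit by (auto simp: c_def)
  \<comment> \<open>As p N satisfies only the first N constraints, this makes each fixed constraint
    hold eventually along the subsequence.\<close>
  have sub: "n \<le> r1 (r2 n)" for n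
    using seq_suble[OF r1, of "r2 n"] seq_suble[OF r2, of n] by linarith
  show ?thesis
  proof (rule primal_value_le_of_escape[OF _ c Q0 _ cont growth])
    show "\<mu> \<in> P_log" using \<mu> lp by (simp add: P_log_iff)
    show "(\<integral>\<^sup>+ z. log_neg (cpoly (Q n)) z \<partial>\<mu>) \<le>
      (\<integral>\<^sup>+ z. log_pos (cpoly (Q n)) z \<partial>\<mu>) + ennreal (real (degree (Q n)) * c)" for n
    proof -
      have "\<forall>\<^sub>F k in sequentially. (\<forall>z\<in>set_pmf (p (r1 (r2 k))). poly (cpoly (Q n)) z \<noteq> 0) \<and>
          ?E (p (r1 (r2 k))) (?f n) \<ge> 0"
        using eventually_gt_at_top[of n]
      proof eventually_elim
        case (elim k)
        then have "n < r1 (r2 k)" using sub[of k] by linarith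
        then show ?case by (rule p(3))
      qed
      from log_neg_limit[OF cpoly_nonzero[OF Q0] this] show ?thesis by (simp add: c_def)
    qed
    have "(\<lambda>n. ?E (p (r1 (r2 n))) g) \<longlonglongrightarrow> integral\<^sup>L \<mu> g + 1 * c"
      unfolding c_def using limit_of_log_growth[OF cont, of 1] growth_log_plus[OF cont growth] by auto
    then show "integral\<^sup>L \<mu> g + c \<le> v"
      using p(2) by (auto intro: LIMSEQ_le_const2 less_imp_le)
  qed
qed

theorem theorem5p3:
  fixes Q :: "nat \<Rightarrow> int poly" and g :: "complex \<Rightarrow> real"
  assumes enum: "bij_betw Q UNIV primitive_irreducible_polys"
    and cont: "continuous_on UNIV g"
    and growth: "(\<lambda>z. g z - ln (cmod z)) \<in> o[at_infinity](\<lambda>z. ln (cmod z))"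
  shows "dual_value Q g = primal_value Q g \<and> primal_value Q g \<in> range ereal"
proof -
  have Q: "degree (Q n) > 0" for n
    using bij_betw_apply[OF enum, of n] by (simp add: primitive_irreducible_polys_def)
  then have Q0: "Q n \<noteq> 0" for n by (metis degree_0 less_irrefl)
  obtain B where B: "\<And>z. \<bar>g z - log_plus z\<bar> \<le> 1 * log_plus z + B"
    using growth_log_plus[OF cont growth, of 1] by auto
  have gm: "g \<in> borel_measurable borel" using cont by (rule borel_measurable_continuous_onI)
  have gi: "integrable \<mu> g" if "\<mu> \<in> primal_feasible Q" for \<mu>
    by (rule integrable_log_growth[where \<kappa> = 1 and \<epsilon> = 1 and B = B])
      (use that gm B in \<open>auto simp: P_log_iff primal_feasible_iff\<close>)
  have ext: "ext_integral \<mu> (\<lambda>z. ereal (g z)) = ereal (integral\<^sup>L \<mu> g)" if "\<mu> \<in> primal_feasible Q" for \<mu>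
    by (rule ext_integral_real[OF gi[OF that]])
  have weak: "dual_value Q g \<le> primal_value Q g"
    unfolding primal_value_def dual_value_def
  proof (intro SUP_least INF_greatest)
    fix a \<mu> assume "a \<in> dual_feasible" "\<mu> \<in> primal_feasible Q"
    then show "(INF z. ereal (g z) - (\<Sum>n | a n \<noteq> 0. ereal (a n) * log_abs_poly (Q n) z))
        \<le> ext_integral \<mu> (\<lambda>z. ereal (g z))"
      using weak_duality gi ext by simp
  qed
  \<comment> \<open>R = exp 4 makes the surplus ln R - 4 zero, enough for feasibility and hence for
    a finite upper bound.\<close>
  have "segment_measure (exp 4) \<in> primal_feasible Q"
    by (rule segment_measure_feasible) (use Q0 in auto)
  then have "primal_value Q g \<le> ereal (integral\<^sup>L (segment_measure (exp 4)) g)"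
    unfolding primal_value_def by (rule INF_lower2) (simp add: ext segment_measure_feasible Q0)
  then have "primal_value Q g \<noteq> \<infinity>" by auto
  \<comment> \<open>Zero multipliers suffice, since \<epsilon> = 1 in the growth bound gives g \<ge>
    -B everywhere.\<close>
  moreover have "ereal (- B) \<le> dual_value Q g"
  proof (rule dual_value_ge[OF cont Q0, where N = 0 and a = "\<lambda>_. 0"])
    show "- B \<le> g z - (\<Sum>i<0. 0 * ln (cmod (poly (cpoly (Q i)) z)))" for z
      using B[of z] by simp
  qed simp
  moreover have "primal_value Q g \<le> dual_value Q g"
  proof (rule ccontr)
    assume "\<not> ?thesis"
    then obtain v where "dual_value Q g < ereal v" "ereal v < primal_value Q g"
      using ereal_dense2 by (meson not_le)
    with primal_value_le[OF cont growth Q] show False by (meson not_le)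
  qed
  ultimately show ?thesis
    using weak by (cases "primal_value Q g") auto
qed

end
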